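(* Let $\alpha,\beta\in\mathbb{C}$ and $M\in\mathbb{R}$ with $0<M\leq|\alpha|$ and $|\beta|\leq 1$, let $\lambda\in\mathbb{D}$ and $z_0\in\mathbb{D}\setminus\{0\}$. Then the boundary $\partial V_1$ of $V_1=V_1(z_0,\lambda)=\{f'(z_0): f\in\mathcal{S}_1(\lambda)\}$ is the Jordan curve given by $$(-\pi,\pi]\ni\theta\mapsto F'_{e^{i\theta},\lambda}(z_0)=\int_0^{z_0}\frac{M\left(\delta(e^{i\theta}\zeta,\lambda)\zeta+\beta\right)}{1+\overline{\beta}\,\delta(e^{i\theta}\zeta,\lambda)\zeta}\,d\zeta+\alpha .$$ Moreover, if $f'(z_0)=F'_{e^{i\theta},\lambda}(z_0)$ for some $f\in\mathcal{S}_1(\lambda)$ and some $\theta\in(-\pi,\pi]$, then $f=F_{e^{i\theta},\lambda}$ on $\mathbb{D}$.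
   Context: $\mathbb{D}=\{z\in\mathbb{C}:|z|<1\}$. For $\alpha,\beta\in\mathbb{C}$, $M\in\mathbb{R}$ with $0<M\le|\alpha|$, $|\beta|\le1$, $\mathcal{B}(\alpha,\beta,M)$ is the class of all functions $f$ analytic and univalent in $\mathbb{D}$ with $f(0)=0$, $f'(0)=\alpha$, $f''(0)=M\beta$ and $|zf''(z)|\leq M$ for all $z\in\mathbb{D}$. For $\lambda\in\overline{\mathbb{D}}$, $\mathcal{S}_1(\lambda)=\{f\in\mathcal{B}(\alpha,\beta,M): f'''(0)=M(1-|\beta|^2)\lambda\}$. For $\lambda\in\mathbb{D}$, $\delta(z,\lambda)=\dfrac{z+\lambda}{1+\overline{\lambda}z}$. For $|a|\le1$, $\lambda\in\mathbb{D}$ and $z\in\mathbb{D}$, $$F_{a,\lambda}(z)=\int_0^z\left\{\int_0^{\zeta_2}\frac{M(\delta(a\zeta_1,\lambda)\zeta_1+\beta)}{1+\overline{\beta}\,\delta(a\zeta_1,\lambda)\zeta_1}\,d\zeta_1\right\}d\zeta_2+\alpha z.$$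
   Formalization: For |β|=1 the curve is the single point Mβz_0+α, so it is not a Jordan curve; injectivity of the curve is therefore claimed only for |β|<1, while the boundary, the integral formula, closedness and uniqueness are proved for all |β|≤1. *)

theory Defs
  imports "HOL-Complex_Analysis.Complex_Analysis"
begin

definition class_B :: "complex \<Rightarrow> complex \<Rightarrow> real \<Rightarrow> (complex \<Rightarrow> complex) set" where
  "class_B \<alpha> \<beta> M = {f. f holomorphic_on ball 0 1 \<and> inj_on f (ball 0 1) \<and>
     f 0 = 0 \<and> deriv f 0 = \<alpha> \<and> (deriv ^^ 2) f 0 = of_real M * \<beta> \<and>
     (\<forall>z\<in>ball 0 1. norm (z * (deriv ^^ 2) f z) \<le> M)}"

definition class_S1 :: "complex \<Rightarrow> complex \<Rightarrow> real \<Rightarrow> complex \<Rightarrow> (complex \<Rightarrow> complex) set" where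
  "class_S1 \<alpha> \<beta> M l =
     {f \<in> class_B \<alpha> \<beta> M. (deriv ^^ 3) f 0 = of_real (M * (1 - (norm \<beta>)\<^sup>2)) * l}"

definition V1 :: "complex \<Rightarrow> complex \<Rightarrow> real \<Rightarrow> complex \<Rightarrow> complex \<Rightarrow> complex set" where
  "V1 \<alpha> \<beta> M z0 l = {deriv f z0 |f. f \<in> class_S1 \<alpha> \<beta> M l}"

definition \<delta> :: "complex \<Rightarrow> complex \<Rightarrow> complex" where
  "\<delta> z l = (z + l) / (1 + cnj l * z)"

definition integrand :: "complex \<Rightarrow> real \<Rightarrow> complex \<Rightarrow> complex \<Rightarrow> complex \<Rightarrow> complex" where
  "integrand \<beta> M a l \<zeta> =
     of_real M * (\<delta> (a * \<zeta>) l * \<zeta> + \<beta>) / (1 + cnj \<beta> * \<delta> (a * \<zeta>) l * \<zeta>)"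

text \<open>The integrands are holomorphic in the unit disc, so the integrals from 0 to a point are
  independent of the path there; they are taken along the segment.\<close>

definition F :: "complex \<Rightarrow> complex \<Rightarrow> real \<Rightarrow> complex \<Rightarrow> complex \<Rightarrow> complex \<Rightarrow> complex" where
  "F \<alpha> \<beta> M a l z =
     contour_integral (linepath 0 z)
       (\<lambda>\<zeta>\<^sub>2. contour_integral (linepath 0 \<zeta>\<^sub>2) (\<lambda>\<zeta>\<^sub>1. integrand \<beta> M a l \<zeta>\<^sub>1)) + \<alpha> * z"

text \<open>As a function of the angle. It is a Jordan curve when the norm of \<open>\<beta>\<close> is less than 1;
  when the norm of \<open>\<beta>\<close> is 1, \<open>integrand \<beta> M a l \<zeta>\<close> equals \<open>M * \<beta>\<close> throughout the unit disc
  (for a, l with norm at most 1 and less than 1), so the curve degenerates to a single point.\<close>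

definition F'_curve ::
    "complex \<Rightarrow> complex \<Rightarrow> real \<Rightarrow> complex \<Rightarrow> complex \<Rightarrow> real \<Rightarrow> complex" where
  "F'_curve \<alpha> \<beta> M l z0 \<theta> = deriv (F \<alpha> \<beta> M (cis \<theta>) l) z0"

end

theory Submission
  imports Defs
begin

text \<open>
  \<^bold>\<open>Reduction to bounded functions.\<close> For \<open>f\<close> in the class put \<open>g = f'' / M\<close>. The Schwarz lemma applied
  to \<open>z f''(z)\<close> turns \<open>|z f''(z)| \<le> M\<close> into \<open>|g| \<le> 1\<close>, and the conditions at 0 prescribe \<open>g 0 = \<beta>\<close> and
  \<open>g' 0 = (1 - |\<beta>|\<^sup>2) \<lambda>\<close>. Conversely, every such \<open>g\<close> comes from a member of the class: univalence is
  automatic, since \<open>|f' - \<alpha>| < M \<le> |\<alpha>|\<close> keeps \<open>f'\<close> in a half plane. So the values \<open>f' z0\<close> are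
  \<open>\<alpha>\<close> plus \<open>M\<close> times the integral of \<open>g\<close> from 0 to \<open>z0\<close>. They form a convex set, which is closed by
  Montel's theorem.

  \<^bold>\<open>The extremal inequality.\<close> Let \<open>|\<beta>| < 1\<close>. Two steps of the Schur algorithm write
  \<open>g(z) = \<delta> (\<delta> (\<phi>(z) * z) \<lambda> * z) \<beta>\<close> with \<open>|\<phi>| \<le> 1\<close>, and the curve consists of the functions with
  \<open>\<phi>\<close> a unimodular constant \<open>a\<close>. For fixed \<open>z \<noteq> 0\<close> the right-hand side is a Moebius function of \<open>w = \<phi>(z)\<close> with
  denominator \<open>d\<^sub>w(z)\<close>, so \<open>g(z)\<close> ranges over a closed disc which lies on one side of its tangent at the point
  belonging to \<open>a\<close>; the outer normal there is a positive multiple of \<open>a G'(z)\<close>, where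
  \<open>G' = z\<^sup>2 / d\<^sub>a\<^sup>2\<close>. The function \<open>G\<close> satisfies \<open>Re (z G'/G) > 0\<close>, and for such \<open>G\<close> a bound
  \<open>Re (H'/(aG')) < 0\<close> integrates to \<open>Re (H/(aG)) < 0\<close> (Libera's lemma). Both of these facts follow by looking at
  the first point where a real part vanishes (\<open>first_touch\<close>). The outcome is \<open>schur_class_extremal\<close>: unless \<open>f\<close> is the
  extremal function with parameter \<open>a\<close>, the point \<open>f' z0\<close> lies strictly on one side of a line with normal
  \<open>a G(z0)\<close> through the curve point.

  \<^bold>\<open>The boundary.\<close> This strict inequality gives at once that curve points are boundary points, that the extremal
  function is unique, and that the curve is injective. To see that every boundary point lies on the curve, take
  a supporting line there. The outer normals \<open>a G(z0)\<close> attain every direction as \<open>a\<close> runs over the unit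
  circle, because \<open>G(z0)\<close> has no zero for \<open>|a| \<le> 1\<close> and therefore has a continuous logarithm in \<open>a\<close>
  (\<open>weight_attains_direction\<close>). For the \<open>a\<close> that matches the supporting line, the strict inequality forces the
  boundary point to be the curve point. If \<open>|\<beta>| = 1\<close>, then \<open>g\<close> is constant and the set is one point.
\<close>

section \<open>First-touch arguments in the unit disc\<close>

text \<open>At a point \<open>z\<close> of least modulus with \<open>Re (p z) \<le> 0\<close>, the function \<open>Re p\<close> vanishes, while it is positive on
  the disc of radius \<open>|z|\<close>. Hence its derivative at \<open>z\<close> in every inward direction is nonnegative, which leaves
  for \<open>z p'(z)\<close> only the nonpositive reals (Jack's lemma in half-plane form).\<close>

lemma first_touch:
  assumes hol: "p holomorphic_on ball 0 1" and p0: "Re (p 0) > 0"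
    and z': "z' \<in> ball 0 1" "Re (p z') \<le> 0"
  obtains z where "z \<in> ball 0 1" "Re (p z) = 0" "Im (z * deriv p z) = 0" "Re (z * deriv p z) \<le> 0"
proof -
  define K where "K = {z \<in> cball 0 (norm z'). Re (p z) \<le> 0}"
  have cont: "continuous_on (ball 0 1) p"
    using hol by (rule holomorphic_on_imp_continuous_on)
  have sub: "cball 0 (norm z') \<subseteq> ball (0::complex) 1"
    using z' by auto
  have "closed K"
    unfolding K_def
    by (intro continuous_on_closed_Collect_le continuous_intros continuous_on_subset[OF cont sub] closed_cball)
  then have "compact K"
    using compact_cball by (auto simp: K_def compact_eq_bounded_closed bounded_iff)
  moreover have "K \<noteq> {}"
    using z' by (auto simp: K_def)
  ultimately obtain z where z: "z \<in> K" and min: "\<And>w. w \<in> K \<Longrightarrow> norm z \<le> norm w"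
    using continuous_attains_inf[of K norm] by (auto intro: continuous_intros)
  have zb: "z \<in> ball 0 1" and znp: "Re (p z) \<le> 0"
    using z sub by (auto simp: K_def)
  have pos: "Re (p w) > 0" if "norm w < norm z" for w
    using min[of w] that z by (force simp: K_def)
  have [simp]: "z \<noteq> 0"
    using znp p0 by auto
  have dp: "(p has_field_derivative deriv p z) (at z)"
    using hol zb by (simp add: holomorphic_derivI)
  have key: "Re (w * (z * deriv p z)) \<ge> 0 \<and> Re (p z) \<ge> 0" if w: "Re w < 0" for w
  proof -
    \<comment> \<open>Moving from \<open>z\<close> along \<open>z * exp (s * w)\<close> decreases the modulus for \<open>s > 0\<close>.\<close>
    define m where "m s = Re (p (z * exp (of_real s * w)))" for s :: real
    have "((\<lambda>s::complex. p (z * exp (s * w))) has_field_derivative deriv p z * (z * w)) (at 0)"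
      by (rule DERIV_chain2[of p _ "\<lambda>s. z * exp (s * w)"])
         (use dp in \<open>auto intro!: derivative_eq_intros\<close>)
    then have dm: "(m has_real_derivative Re (w * (z * deriv p z))) (at 0)"
      unfolding m_def
      by (intro has_field_derivative_Re has_vector_derivative_real_field)
        (auto simp: mult_ac)
    have mpos: "m s > 0" if "s > 0" for s
      unfolding m_def by (rule pos) (use w that in \<open>auto simp: norm_mult mult_pos_neg\<close>)
    have m0: "m 0 \<ge> 0"
    proof (rule ccontr)
      assume "\<not> m 0 \<ge> 0"
      have "isCont m 0"
        using dm by (rule DERIV_isCont)
      then have "(m \<longlongrightarrow> m 0) (at_right 0)"
        using isCont_def tendsto_within_subset by (metis at_within_le_at filterlim_mono order_refl)
      moreover have "eventually (\<lambda>s. m s \<ge> 0) (at_right 0)"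
        using mpos by (auto simp: eventually_at_filter less_imp_le)
      ultimately have "m 0 \<ge> 0"
        by (intro tendsto_lowerbound[of m "m 0" "at_right 0" 0]) simp_all
      with \<open>\<not> m 0 \<ge> 0\<close> show False by simp
    qed
    then have "m 0 = 0"
      using znp by (simp add: m_def)
    have "Re (w * (z * deriv p z)) \<ge> 0"
    proof (rule ccontr)
      assume "\<not> ?thesis"
      then obtain d where d: "d > 0" "\<And>h. h > 0 \<Longrightarrow> h < d \<Longrightarrow> m (0 + h) < m 0"
        using DERIV_neg_dec_right[OF dm] by auto
      have "m (d/2) < 0"
        using d(2)[of "d/2"] d(1) \<open>m 0 = 0\<close> by simp
      then show False
        using mpos[of "d/2"] d(1) by simp
    qed
    then show ?thesis
      using m0 by (simp add: m_def)
  qed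
  have "Re (p z) = 0"
    using key[of "-1"] znp by simp
  moreover have re: "Re (z * deriv p z) \<le> 0"
    using key[of "-1"] by simp
  moreover have "Im (z * deriv p z) = 0"
  proof (rule ccontr)
    define D where "D = z * deriv p z"
    assume "Im (z * deriv p z) \<noteq> 0"
    then have im: "Im D \<noteq> 0" and reD: "Re D \<le> 0"
      using re by (auto simp: D_def)
    \<comment> \<open>A nonzero imaginary part of \<open>D\<close> admits an inward direction with \<open>Re (w * D) = -1\<close>.\<close>
    define w where "w = Complex (-1) ((1 - Re D) / Im D)"
    have "Re (w * D) = - Re D - (1 - Re D)"
      using im by (simp add: w_def)
    then show False
      using key[of w] by (simp add: w_def D_def)
  qed
  ultimately show ?thesis
    using that zb by blast
qed

text \<open>With \<open>t = G / (z G')\<close> and \<open>Q = 1 + z G''/G'\<close> the differential equation is an identity, so this is the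
  step from convexity, \<open>Re Q > 0\<close>, to starlikeness, \<open>Re (z G'/G) > 0\<close>. At a first point where \<open>Re t = 0\<close>, the product \<open>t Q = 1 - z t'\<close>
  would be real and at least 1, although \<open>t\<close> is imaginary and \<open>Re Q > 0\<close>. Working with \<open>t\<close> instead of its
  reciprocal \<open>z G'/G\<close> avoids having to know beforehand that \<open>G\<close> has no zeros.\<close>

lemma Re_pos_reciprocal:
  assumes hol: "t holomorphic_on ball 0 1"
    and ode: "\<And>z. z \<in> ball 0 1 \<Longrightarrow> z * deriv t z = 1 - t z * Q z"
    and Q: "\<And>z. z \<in> ball 0 1 \<Longrightarrow> Re (Q z) > 0"
    and z: "z \<in> ball 0 1"
  shows "Re (t z) > 0"
proof (rule ccontr)
  assume "\<not> Re (t z) > 0"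
  have "t 0 * Q 0 = 1"
    using ode[of 0] by simp
  then have "t 0 = cnj (Q 0) / (norm (Q 0))\<^sup>2"
    using complex_div_cnj[of 1 "Q 0"] by (metis mult_1 mult_zero_right nonzero_eq_divide_eq zero_neq_one)
  then have "Re (t 0) > 0"
    using Q[of 0] by (auto simp: complex_eq_iff intro!: divide_pos_pos)
  then obtain w where w: "w \<in> ball 0 1" "Re (t w) = 0" "Im (w * deriv t w) = 0"
      "Re (w * deriv t w) \<le> 0"
    using first_touch[OF hol _ z] \<open>\<not> Re (t z) > 0\<close> by force
  have "Im (t w * Q w) = 0" "Re (t w * Q w) \<ge> 1"
    using w ode[OF w(1)] by auto
  then show False
    using w(2) Q[OF w(1)] by auto
qed

text \<open>Libera's lemma: for \<open>p = H/G\<close> and \<open>t = G/(z G')\<close> the left-hand side of the differential equation is \<open>H'/G'\<close>.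
  At a first point where \<open>Re p = 0\<close>, the number \<open>z p'\<close> is real and nonnegative, so the left-hand
  side has nonnegative real part.\<close>

lemma Re_neg_subordination:
  assumes hol: "p holomorphic_on ball 0 1"
    and ode: "\<And>z. z \<in> ball 0 1 \<Longrightarrow> p z + z * deriv p z * t z = q z"
    and t: "\<And>z. z \<in> ball 0 1 \<Longrightarrow> Re (t z) > 0"
    and q: "\<And>z. z \<in> ball 0 1 \<Longrightarrow> Re (q z) < 0"
    and z: "z \<in> ball 0 1"
  shows "Re (p z) < 0"
proof (rule ccontr)
  assume "\<not> Re (p z) < 0"
  have "Re (- p 0) > 0"
    using ode[of 0] q[of 0] by simp
  moreover have "(\<lambda>z. - p z) holomorphic_on ball 0 1"
    using hol by (intro holomorphic_intros)
  ultimately obtain w where w: "w \<in> ball 0 1" "Re (- p w) = 0" "Im (w * deriv (\<lambda>z. - p z) w) = 0"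
      "Re (w * deriv (\<lambda>z. - p z) w) \<le> 0"
    using first_touch[of "\<lambda>z. - p z", OF _ _ z] \<open>\<not> Re (p z) < 0\<close> by force
  have "deriv (\<lambda>z. - p z) w = - deriv p w"
    using hol w(1) by (simp add: holomorphic_on_imp_differentiable_at)
  with w have "Im (w * deriv p w) = 0" "Re (w * deriv p w) \<ge> 0"
    by simp_all
  then have "Re (w * deriv p w * t w) \<ge> 0"
    using t[OF w(1)] by (subst times_complex.simps) simp
  then show False
    using ode[OF w(1)] q[OF w(1)] w(2) by (metis add_0 neg_equal_0_iff_equal not_less plus_complex.simps(1) uminus_complex.simps(1))
qed

text \<open>Factor the quadratic as \<open>(1 + p z) (1 + q z)\<close>. Since it has no zero in the disc, \<open>p\<close> and \<open>q\<close> have modulus at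
  most 1, and the fraction is the sum of \<open>u / (1 + u)\<close> for \<open>u = p z\<close> and \<open>u = q z\<close>; the map
  \<open>u \<mapsto> u / (1 + u)\<close> sends the unit disc to the half plane \<open>Re < 1/2\<close>.\<close>

lemma quadratic_log_deriv:
  fixes B C :: complex
  assumes nz: "\<And>z. z \<in> ball 0 1 \<Longrightarrow> 1 + B * z + C * z\<^sup>2 \<noteq> 0" and z: "z \<in> ball 0 1"
  shows "Re ((B * z + 2 * C * z\<^sup>2) / (1 + B * z + C * z\<^sup>2)) < 1"
proof -
  define p q where "p = (B + csqrt (B\<^sup>2 - 4 * C)) / 2" and "q = (B - csqrt (B\<^sup>2 - 4 * C)) / 2"
  have sum: "p + q = B"
    by (simp add: p_def q_def field_simps)
  have "(B + csqrt (B\<^sup>2 - 4 * C)) * (B - csqrt (B\<^sup>2 - 4 * C)) = B\<^sup>2 - (csqrt (B\<^sup>2 - 4 * C))\<^sup>2"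
    by (simp add: algebra_simps power2_eq_square)
  then have prod: "p * q = C"
    by (simp add: p_def q_def)
  have fact: "1 + B * z + C * z\<^sup>2 = (1 + p * z) * (1 + q * z)" for z
    by (simp flip: sum prod add: algebra_simps power2_eq_square)
  have half: "Re (r * z / (1 + r * z)) < 1/2" "1 + r * z \<noteq> 0" if r: "r = p \<or> r = q" for r
  proof -
    have "norm r \<le> 1"
    proof (rule ccontr)
      assume "\<not> norm r \<le> 1"
      then have "-1/r \<in> ball 0 1" and "r \<noteq> 0"
        by (auto simp: norm_divide divide_simps)
      then show False
        using nz[of "-1/r"] fact[of "-1/r"] r by auto
    qed
    then have n: "norm (r * z) < 1"
      using z mult_left_le_one_le[of "norm z" "norm r"] by (simp add: norm_mult)
    then show ne: "1 + r * z \<noteq> 0"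
      by (metis add.commute add_eq_0_iff2 less_irrefl norm_minus_cancel norm_one)
    define u where "u = r * z"
    have u: "(Re u)\<^sup>2 + (Im u)\<^sup>2 < 1"
      using n by (simp add: u_def cmod_def)
    have "1 + u \<noteq> 0" using ne by (simp add: u_def)
    then have pos: "(1 + Re u)\<^sup>2 + (Im u)\<^sup>2 > 0"
      by (auto simp: complex_eq_iff sum_power2_gt_zero_iff)
    have "Re (u / (1 + u)) = (Re u * (1 + Re u) + Im u * Im u) / ((1 + Re u)\<^sup>2 + (Im u)\<^sup>2)"
      by (simp add: Re_divide)
    also have "\<dots> < 1/2"
      using pos u by (simp add: divide_simps) (simp add: power2_eq_square algebra_simps)
    finally show "Re (r * z / (1 + r * z)) < 1/2"
      by (simp add: u_def)
  qed
  have "(B * z + 2 * C * z\<^sup>2) / (1 + B * z + C * z\<^sup>2) = p * z / (1 + p * z) + q * z / (1 + q * z)"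
    unfolding fact using half(2)
    by (simp add: divide_simps) (simp flip: sum prod add: algebra_simps power2_eq_square)
  then show ?thesis
    using half(1)[of p] half(1)[of q] by simp
qed

text \<open>The Schwarz lemma for a weak bound on \<open>f\<close>, obtained by letting \<open>e\<close> tend to 0 in the strict one for \<open>f / (B + e)\<close>.\<close>

lemma holomorphic_divisible_by_z:
  assumes hol: "f holomorphic_on ball 0 1" and f0: "f 0 = 0"
    and B: "\<And>z. z \<in> ball 0 1 \<Longrightarrow> norm (f z) \<le> B"
  obtains h where "h holomorphic_on ball 0 1" "\<And>z. z \<in> ball 0 1 \<Longrightarrow> f z = z * h z" "h 0 = deriv f 0"
    "\<And>z. z \<in> ball 0 1 \<Longrightarrow> norm (h z) \<le> B"
proof -
  obtain h where h: "h holomorphic_on ball 0 1" "\<And>z. norm z < 1 \<Longrightarrow> f z = z * h z" "deriv f 0 = h 0"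
    using Schwarz3[OF hol f0] by blast
  have B0: "B \<ge> 0"
    using B[of 0] f0 by simp
  have "norm (h z) \<le> B" if z: "z \<in> ball 0 1" for z
  proof (rule field_le_epsilon)
    fix e :: real assume "e > 0"
    then have Be: "B + e > 0" using B0 by simp
    define g where "g z = f z / of_real (B + e)" for z
    have g: "g holomorphic_on ball 0 1"
      unfolding g_def using hol Be by (intro holomorphic_intros) (auto simp: complex_eq_iff)
    have lt: "norm (g z) < 1" if "norm z < 1" for z
    proof -
      have "norm (f z) < B + e"
        using B[of z] that \<open>e > 0\<close> by simp
      then show ?thesis
        using Be unfolding g_def norm_divide norm_of_real by (simp add: divide_simps)
    qed
    show "norm (h z) \<le> B + e"
    proof (cases "z = 0")
      case False
      have "norm (g z) \<le> norm z"
        using Schwarz_Lemma(1)[OF g _ lt] f0 z by (simp add: g_def)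
      then have "norm (f z) \<le> norm z * (B + e)"
        using Be unfolding g_def norm_divide norm_of_real by (simp add: divide_simps)
      then show ?thesis
        using h(2)[of z] z False by (simp add: norm_mult)
    next
      case True
      have "deriv g 0 = deriv f 0 / of_real (B + e)"
        unfolding g_def using hol by (intro deriv_cdivide_right) (simp add: holomorphic_on_imp_differentiable_at)
      then have "h 0 = of_real (B + e) * deriv g 0"
        using Be h(3) by (simp add: complex_eq_iff)
      then have "norm (h 0) = (B + e) * norm (deriv g 0)"
        using Be by (metis norm_mult norm_of_real abs_of_pos)
      moreover have "norm (deriv g 0) \<le> 1"
        using Schwarz_Lemma(2)[OF g _ lt, of 0] f0 by (metis div_0 g_def norm_zero zero_less_one)
      ultimately show ?thesis
        using Be True by simp
    qed
  qed
  then show ?thesis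
    using h that[of h] by auto
qed

section \<open>Primitives in the unit disc\<close>

definition prim :: "(complex \<Rightarrow> complex) \<Rightarrow> complex \<Rightarrow> complex" where
  "prim g z = contour_integral (linepath 0 z) g"

lemma prim_eq:
  assumes "\<And>w. w \<in> ball 0 1 \<Longrightarrow> (G has_field_derivative g w) (at w)" and z: "z \<in> ball 0 1"
  shows "prim g z = G z - G 0"
proof -
  have "(g has_contour_integral (G (pathfinish (linepath 0 z)) - G (pathstart (linepath 0 z)))) (linepath 0 z)"
  proof (rule contour_integral_primitive[where S = "ball 0 1"])
    show "path_image (linepath 0 z) \<subseteq> ball 0 1"
      using z by (simp add: closed_segment_subset del: linepath_0)
  qed (use assms in \<open>auto simp: has_field_derivative_at_within simp del: linepath_0\<close>)
  then show ?thesis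
    by (simp add: prim_def contour_integral_unique)
qed

lemma prim_0 [simp]: "prim g 0 = 0"
  by (simp add: prim_def contour_integral_trivial)

lemma has_field_derivative_prim:
  assumes hol: "g holomorphic_on ball 0 1" and z: "z \<in> ball 0 1"
  shows "(prim g has_field_derivative g z) (at z)"
proof -
  obtain G where "\<And>w. w \<in> ball 0 1 \<Longrightarrow> (G has_field_derivative g w) (at w within ball 0 1)"
    using holomorphic_convex_primitive'[OF convex_ball open_ball hol] by blast
  then have G: "\<And>w. w \<in> ball 0 1 \<Longrightarrow> (G has_field_derivative g w) (at w)"
    by (metis at_within_open open_ball)
  have "((\<lambda>w. G w - G 0) has_field_derivative g z - 0) (at z)"
    by (intro DERIV_diff G z DERIV_const)
  then have "((\<lambda>w. G w - G 0) has_field_derivative g z) (at z)"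
    by simp
  then show ?thesis
    by (rule has_field_derivative_transform_within_open[where S = "ball 0 1"])
      (use z prim_eq[OF G] in auto)
qed

lemma deriv_prim:
  "g holomorphic_on ball 0 1 \<Longrightarrow> z \<in> ball 0 1 \<Longrightarrow> deriv (prim g) z = g z"
  by (rule DERIV_imp_deriv) (rule has_field_derivative_prim)

lemma holomorphic_prim:
  "g holomorphic_on ball 0 1 \<Longrightarrow> prim g holomorphic_on ball 0 1"
  by (meson has_field_derivative_prim holomorphic_on_open open_ball)

lemma prim_cong:
  assumes "\<And>w. w \<in> ball 0 1 \<Longrightarrow> f w = g w" and "z \<in> ball 0 1"
  shows "prim f z = prim g z"
proof -
  have "path_image (linepath 0 z) \<subseteq> ball 0 1"
    using assms(2) by (auto simp: closed_segment_subset)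
  then show ?thesis
    unfolding prim_def using assms(1) by (intro contour_integral_cong) auto
qed

lemma prim_linear:
  assumes "f holomorphic_on ball 0 1" "g holomorphic_on ball 0 1" "z \<in> ball 0 1"
  shows "prim (\<lambda>w. a * f w + b * g w) z = a * prim f z + b * prim g z"
proof -
  have "((\<lambda>w. a * prim f w + b * prim g w) has_field_derivative a * f w + b * g w) (at w)"
    if "w \<in> ball 0 1" for w
    using has_field_derivative_prim[OF assms(1) that] has_field_derivative_prim[OF assms(2) that]
    by (auto intro!: derivative_eq_intros)
  from prim_eq[OF this assms(3)] show ?thesis
    by simp
qed

lemma prim_cmult:
  assumes "f holomorphic_on ball 0 1" "z \<in> ball 0 1"
  shows "prim (\<lambda>w. a * f w) z = a * prim f z"
  using prim_linear[OF assms(1) holomorphic_on_const assms(2), of a 0] by simp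

lemma norm_prim_le:
  assumes "g holomorphic_on ball 0 1" "\<And>z. z \<in> ball 0 1 \<Longrightarrow> norm (g z) \<le> 1" "z \<in> ball 0 1"
  shows "norm (prim g z) \<le> norm z"
proof -
  have "norm (prim g z - prim g 0) \<le> 1 * norm (z - 0)"
    by (rule field_differentiable_bound[OF convex_ball[of 0 1], where f' = g])
      (use assms has_field_derivative_prim in \<open>auto intro: has_field_derivative_at_within\<close>)
  then show ?thesis by simp
qed

text \<open>Away from 0 this is the product rule, divided by \<open>z ^ n\<close>; at 0 it holds by continuity.\<close>

lemma deriv_factor_power:
  assumes hol: "S holomorphic_on ball 0 1" "k holomorphic_on ball 0 1"
    and eq: "\<And>z. z \<in> ball 0 1 \<Longrightarrow> prim (\<lambda>w. w ^ n * k w) z = z ^ Suc n * S z"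
    and z: "z \<in> ball 0 1"
  shows "of_nat (Suc n) * S z + z * deriv S z = k z"
proof -
  have off0: "of_nat (Suc n) * S z + z * deriv S z = k z" if z: "z \<in> ball 0 1" "z \<noteq> 0" for z
  proof -
    have "(prim (\<lambda>w. w ^ n * k w) has_field_derivative z ^ n * k z) (at z)"
      using hol z by (intro has_field_derivative_prim holomorphic_intros)
    then have 1: "((\<lambda>z. z ^ Suc n * S z) has_field_derivative z ^ n * k z) (at z)"
      by (rule has_field_derivative_transform_within_open[where S = "ball 0 1"]) (use eq z in auto)
    have "(S has_field_derivative deriv S z) (at z)"
      using hol z by (intro holomorphic_derivI[where S = "ball 0 1"]) auto
    then have "((\<lambda>z. z ^ Suc n * S z) has_field_derivative
        of_nat (Suc n) * z ^ n * S z + z ^ Suc n * deriv S z) (at z)"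
      using DERIV_mult[OF DERIV_power[OF DERIV_ident, where n = "Suc n"]] by (fastforce simp: mult_ac)
    with 1 have "z ^ n * k z = of_nat (Suc n) * z ^ n * S z + z ^ Suc n * deriv S z"
      by (rule DERIV_unique)
    also have "\<dots> = z ^ n * (of_nat (Suc n) * S z + z * deriv S z)"
      by (simp add: algebra_simps)
    finally show ?thesis
      using z(2) by simp
  qed
  show ?thesis
  proof (cases "z = 0")
    case True
    define d where "d z = of_nat (Suc n) * S z + z * deriv S z - k z" for z
    have "d holomorphic_on ball 0 1"
      unfolding d_def using hol by (intro holomorphic_intros holomorphic_deriv) auto
    then have "isCont d 0"
      using holomorphic_on_imp_continuous_on[of d "ball 0 1"] by (simp add: continuous_on_eq_continuous_at)
    then have "(d \<longlongrightarrow> d 0) (at 0)"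
      by (simp add: isCont_def)
    moreover have "eventually (\<lambda>z. d z = 0) (at 0)"
      using off0 unfolding d_def eventually_at by (intro exI[of _ 1]) auto
    ultimately have "d 0 = 0"
      by (metis tendsto_eventually tendsto_unique trivial_limit_at)
    then show ?thesis
      using True by (simp add: d_def)
  qed (use off0 z in auto)
qed

text \<open>Removing the zero of order \<open>n + 1\<close> at the origin from a primitive. The quotients \<open>H/G\<close> and \<open>G/(z G')\<close> of the
  extremal argument become holomorphic at 0 in terms of such cofactors \<open>S\<close>.\<close>

lemma prim_power_mult:
  assumes "k holomorphic_on ball 0 1"
  obtains S where "S holomorphic_on ball 0 1"
    "\<And>z. z \<in> ball 0 1 \<Longrightarrow> prim (\<lambda>w. w ^ n * k w) z = z ^ Suc n * S z"
    "\<And>z. z \<in> ball 0 1 \<Longrightarrow> of_nat (Suc n) * S z + z * deriv S z = k z"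
proof -
  have "\<exists>S. S holomorphic_on ball 0 1 \<and> (\<forall>z\<in>ball 0 1. prim (\<lambda>w. w ^ n * k w) z = z ^ Suc n * S z)"
    using assms
  proof (induction n arbitrary: k)
    case 0
    show ?case
      by (rule Schwarz3[of "prim k" 1]) (use 0 holomorphic_prim in auto)
  next
    case (Suc n)
    have hol: "(\<lambda>w. w * k w) holomorphic_on ball 0 1"
      using Suc.prems by (intro holomorphic_intros)
    then obtain S where S: "S holomorphic_on ball 0 1"
        "\<forall>z\<in>ball 0 1. prim (\<lambda>w. w ^ n * (w * k w)) z = z ^ Suc n * S z"
      using Suc.IH by blast
    then have "of_nat (Suc n) * S 0 = 0"
      using deriv_factor_power[of S "\<lambda>w. w * k w" n 0] hol by simp
    then have "S 0 = 0"
      by (metis mult_eq_0_iff of_nat_eq_0_iff Suc_neq_Zero)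
    then obtain h where "h holomorphic_on ball 0 1" "\<And>z. norm z < 1 \<Longrightarrow> S z = z * h z"
      using Schwarz3[OF S(1)] by blast
    then show ?case
      using S(2) by (intro exI[of _ h]) (simp add: mult_ac)
  qed
  then show ?thesis
    using that deriv_factor_power[OF _ assms] by blast
qed

section \<open>The Schur parametrization and its kernel\<close>

lemma norm_delta_le_1:
  assumes "norm u \<le> 1" "norm c \<le> 1"
  shows "norm (\<delta> u c) \<le> 1"
proof -
  have "(norm (1 + cnj c * u))\<^sup>2 - (norm (u + c))\<^sup>2 = (1 - (norm u)\<^sup>2) * (1 - (norm c)\<^sup>2)"
    unfolding cmod_power2 by (simp, algebra)
  also have "\<dots> \<ge> 0"
    using assms by (intro mult_nonneg_nonneg) (simp_all add: power_le_one)
  finally have "norm (u + c) \<le> norm (1 + cnj c * u)"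
    by (metis diff_ge_0_iff_ge norm_ge_zero power2_le_imp_le)
  then show ?thesis
    by (simp add: \<delta>_def norm_divide divide_le_eq_1)
qed

lemma one_plus_cnj_mult_nonzero:
  fixes u c :: complex
  assumes "norm u \<le> 1" "norm c \<le> 1" "norm u < 1 \<or> norm c < 1"
  shows "1 + cnj c * u \<noteq> 0"
proof
  assume "1 + cnj c * u = 0"
  then have "norm (cnj c * u) = 1"
    by (metis add_eq_0_iff norm_minus_cancel norm_one)
  then have "norm c * norm u = 1"
    by (simp add: norm_mult)
  then show False
    using assms by (smt (verit) mult_left_le mult_less_cancel_left2 norm_ge_zero mult.commute mult_cancel_right1)
qed

text \<open>The value at \<open>z\<close> of a bounded function whose first two Schur parameters are \<open>\<beta>\<close> and \<open>l\<close>, as a function of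
  the value \<open>w\<close> of the remaining free function.\<close>

definition schur :: "complex \<Rightarrow> complex \<Rightarrow> complex \<Rightarrow> complex \<Rightarrow> complex" where
  "schur \<beta> l w z = \<delta> (\<delta> (w * z) l * z) \<beta>"

lemma integrand_eq_schur: "integrand \<beta> M a l z = of_real M * schur \<beta> l a z"
  by (simp add: integrand_def schur_def \<delta>_def[of _ \<beta>] mult.assoc)

text \<open>The denominator of \<open>schur \<beta> l w z\<close> when it is written as a Moebius function of \<open>w\<close>; see \<open>schur_fraction\<close>.\<close>

definition den :: "complex \<Rightarrow> complex \<Rightarrow> complex \<Rightarrow> complex \<Rightarrow> complex" where
  "den \<beta> l w z = 1 + (w * cnj l + cnj \<beta> * l) * z + w * cnj \<beta> * z\<^sup>2"

lemma holomorphic_den: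
  "\<phi> holomorphic_on S \<Longrightarrow> (\<lambda>z. den \<beta> l (\<phi> z) z) holomorphic_on S"
  unfolding den_def by (intro holomorphic_intros)

text \<open>The function \<open>G\<close> whose multiples \<open>a * G\<close> give the outer normal directions: up to the
  factor \<open>(1 - |\<beta>|\<^sup>2) (1 - |l|\<^sup>2)\<close>, the function \<open>z\<^sup>2 / (den \<beta> l a z)\<^sup>2\<close> is the derivative of \<open>schur \<beta> l w z\<close> with respect to \<open>w\<close> at \<open>w = a\<close>, by \<open>schur_diff\<close>.\<close>

definition weight :: "complex \<Rightarrow> complex \<Rightarrow> complex \<Rightarrow> complex \<Rightarrow> complex" where
  "weight \<beta> l a = prim (\<lambda>z. z\<^sup>2 * (1 / (den \<beta> l a z)\<^sup>2))"

context
  fixes \<beta> l :: complex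
  assumes \<beta>: "norm \<beta> \<le> 1" and l: "norm l < 1"
begin

text \<open>The denominator \<open>den\<close> is the product of the denominators of the two nested Moebius functions, neither of which
  can vanish in the disc.\<close>

lemma
  assumes "norm w \<le> 1" "z \<in> ball 0 1"
  shows inner_nonzero: "1 + cnj l * (w * z) \<noteq> 0"
    and outer_nonzero: "1 + cnj \<beta> * (\<delta> (w * z) l * z) \<noteq> 0"
    and norm_schur: "norm (schur \<beta> l w z) \<le> 1"
    and den_nonzero: "den \<beta> l w z \<noteq> 0"
proof -
  have wz: "norm (w * z) \<le> 1"
    using assms mult_le_one[of "norm w" "norm z"] by (simp add: norm_mult)
  show 1: "1 + cnj l * (w * z) \<noteq> 0"
    using wz l by (intro one_plus_cnj_mult_nonzero) auto
  have "norm (\<delta> (w * z) l) \<le> 1"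
    using wz l by (intro norm_delta_le_1) auto
  then have lt: "norm (\<delta> (w * z) l * z) < 1"
    using assms(2) mult_left_le_one_le[of "norm z" "norm (\<delta> (w * z) l)"] by (simp add: norm_mult)
  then show 2: "1 + cnj \<beta> * (\<delta> (w * z) l * z) \<noteq> 0"
    using \<beta> by (intro one_plus_cnj_mult_nonzero) auto
  show "norm (schur \<beta> l w z) \<le> 1"
    unfolding schur_def using lt \<beta> by (intro norm_delta_le_1) auto
  have "(1 + cnj l * (w * z)) * (1 + cnj \<beta> * (\<delta> (w * z) l * z)) = den \<beta> l w z"
    using 1 unfolding den_def \<delta>_def
    by (simp add: divide_simps) (simp add: algebra_simps power2_eq_square)
  then show "den \<beta> l w z \<noteq> 0"
    using 1 2 by (metis mult_eq_0_iff)
qed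

lemma schur_fraction:
  assumes "norm w \<le> 1" "z \<in> ball 0 1"
  shows "schur \<beta> l w z = (w * z * (z + \<beta> * cnj l) + (l * z + \<beta>)) / den \<beta> l w z"
proof -
  define A where "A = 1 + cnj l * (w * z)"
  define D where "D = \<delta> (w * z) l * z"
  have A: "A \<noteq> 0" and B: "1 + cnj \<beta> * D \<noteq> 0"
    using inner_nonzero[OF assms] outer_nonzero[OF assms] by (auto simp: A_def D_def)
  have D: "D * A = (w * z + l) * z"
    using A by (simp add: D_def \<delta>_def A_def)
  have "A * (1 + cnj \<beta> * D) = A + cnj \<beta> * (D * A)"
    by (simp add: algebra_simps)
  also have "\<dots> = den \<beta> l w z"
    unfolding D by (simp add: den_def A_def algebra_simps power2_eq_square)
  finally have "den \<beta> l w z = A * (1 + cnj \<beta> * D)" ..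
  moreover have "A * (D + \<beta>) = D * A + \<beta> * A"
    by (simp add: algebra_simps)
  then have "A * (D + \<beta>) = w * z * (z + \<beta> * cnj l) + (l * z + \<beta>)"
    unfolding D by (simp add: A_def algebra_simps power2_eq_square)
  ultimately show ?thesis
    using A by (simp add: schur_def \<delta>_def[of _ \<beta>] flip: D_def) (metis mult_divide_mult_cancel_left)
qed

text \<open>A Moebius function \<open>N/D\<close> of \<open>w\<close> satisfies \<open>N/D (w) - N/D (a) = \<Delta> (w - a) / (D w * D a)\<close> with \<open>\<Delta>\<close> its
  determinant; here the determinant is a nonnegative constant times \<open>z\<^sup>2\<close>.\<close>

lemma schur_diff:
  assumes "norm w \<le> 1" "norm a \<le> 1" "z \<in> ball 0 1"
  shows "schur \<beta> l w z - schur \<beta> l a z =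
    of_real ((1 - (norm \<beta>)\<^sup>2) * (1 - (norm l)\<^sup>2)) * (w - a) * z\<^sup>2 / (den \<beta> l w z * den \<beta> l a z)"
proof -
  have K: "of_real ((1 - (norm \<beta>)\<^sup>2) * (1 - (norm l)\<^sup>2)) = (1 - \<beta> * cnj \<beta>) * (1 - l * cnj l)"
    by (simp add: complex_norm_square del: of_real_power)
  have "(w * z * (z + \<beta> * cnj l) + (l * z + \<beta>)) * den \<beta> l a z
      - (a * z * (z + \<beta> * cnj l) + (l * z + \<beta>)) * den \<beta> l w z
      = (1 - \<beta> * cnj \<beta>) * (1 - l * cnj l) * (w - a) * z\<^sup>2"
    unfolding den_def by algebra
  then show ?thesis
    using den_nonzero[OF assms(1,3)] den_nonzero[OF assms(2,3)]
    unfolding schur_fraction[OF assms(1,3)] schur_fraction[OF assms(2,3)] K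
    by (simp add: diff_frac_eq)
qed

lemma holomorphic_schur:
  assumes "\<phi> holomorphic_on ball 0 1" and "\<And>z. z \<in> ball 0 1 \<Longrightarrow> norm (\<phi> z) \<le> 1"
  shows "(\<lambda>z. schur \<beta> l (\<phi> z) z) holomorphic_on ball 0 1"
proof -
  have "(\<lambda>z. (\<phi> z * z * (z + \<beta> * cnj l) + (l * z + \<beta>)) / den \<beta> l (\<phi> z) z) holomorphic_on ball 0 1"
    using assms den_nonzero by (intro holomorphic_intros holomorphic_den) auto
  then show ?thesis
    by (rule holomorphic_transform) (use assms in \<open>auto simp: schur_fraction\<close>)
qed

text \<open>Here \<open>S * d\<^sup>2\<close>, with \<open>d\<close> the denominator, is \<open>G / (z G')\<close>. Since \<open>1 + z G''/G' = 3 - 2 z d'/d\<close> and \<open>d\<close> is a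
  quadratic without zeros in the disc, \<open>quadratic_log_deriv\<close> bounds this below by 1 in real part, so \<open>G\<close> is
  starlike. The case \<open>|a| < 1\<close> is included because the continuous logarithm below lives on the whole disc.\<close>

lemma weight_starlike:
  assumes a: "norm a \<le> 1"
  obtains S where "S holomorphic_on ball 0 1"
    "\<And>z. z \<in> ball 0 1 \<Longrightarrow> weight \<beta> l a z = z ^ 3 * S z"
    "\<And>z. z \<in> ball 0 1 \<Longrightarrow> 3 * S z + z * deriv S z = 1 / (den \<beta> l a z)\<^sup>2"
    "\<And>z. z \<in> ball 0 1 \<Longrightarrow> Re (S z * (den \<beta> l a z)\<^sup>2) > 0"
proof -
  define d where "d = den \<beta> l a"
  have d0: "d z \<noteq> 0" if "z \<in> ball 0 1" for z
    using den_nonzero[OF a that] by (simp add: d_def)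
  have hold: "d holomorphic_on ball 0 1"
    using holomorphic_den[of "\<lambda>_. a"] by (simp add: d_def)
  have "(\<lambda>z. 1 / (d z)\<^sup>2) holomorphic_on ball 0 1"
    using hold d0 by (intro holomorphic_intros) auto
  then obtain S where S: "S holomorphic_on ball 0 1"
      "\<And>z. z \<in> ball 0 1 \<Longrightarrow> prim (\<lambda>z. z ^ 2 * (1 / (d z)\<^sup>2)) z = z ^ 3 * S z"
      "\<And>z. z \<in> ball 0 1 \<Longrightarrow> 3 * S z + z * deriv S z = 1 / (d z)\<^sup>2"
    by (rule prim_power_mult[where n = 2]) (auto simp: numeral_3_eq_3)
  define d' where "d' z = (a * cnj l + cnj \<beta> * l) + 2 * (a * cnj \<beta>) * z" for z
  have dd: "(d has_field_derivative d' z) (at z)" for z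
    unfolding d_def den_def[abs_def] d'_def by (auto intro!: derivative_eq_intros)
  have pos: "Re (S z * (d z)\<^sup>2) > 0" if z: "z \<in> ball 0 1" for z
  proof (rule Re_pos_reciprocal[where t = "\<lambda>z. S z * (d z)\<^sup>2" and Q = "\<lambda>z. 3 - 2 * (z * d' z / d z)"])
    show "(\<lambda>z. S z * (d z)\<^sup>2) holomorphic_on ball 0 1"
      using S(1) hold by (intro holomorphic_intros)
    show "w * deriv (\<lambda>z. S z * (d z)\<^sup>2) w = 1 - S w * (d w)\<^sup>2 * (3 - 2 * (w * d' w / d w))"
      if w: "w \<in> ball 0 1" for w
    proof -
      have "(S has_field_derivative deriv S w) (at w)"
        using S(1) w by (intro holomorphic_derivI[where S = "ball 0 1"]) auto
      then have "((\<lambda>z. S z * (d z)\<^sup>2) has_field_derivative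
          deriv S w * (d w)\<^sup>2 + S w * (2 * d w * d' w)) (at w)"
        using dd by (auto intro!: derivative_eq_intros)
      then have "w * deriv (\<lambda>z. S z * (d z)\<^sup>2) w =
          (w * deriv S w) * (d w)\<^sup>2 + 2 * S w * d w * (w * d' w)"
        by (simp add: DERIV_imp_deriv algebra_simps)
      also have "w * deriv S w = 1 / (d w)\<^sup>2 - 3 * S w"
        using S(3)[OF w] by (simp add: eq_diff_eq add.commute)
      also have "(1 / (d w)\<^sup>2 - 3 * S w) * (d w)\<^sup>2 + 2 * S w * d w * (w * d' w) =
          1 - S w * (d w)\<^sup>2 * (3 - 2 * (w * d' w / d w))"
        using d0[OF w] by (simp add: field_simps power2_eq_square)
      finally show ?thesis .
    qed
    show "Re (3 - 2 * (w * d' w / d w)) > 0" if w: "w \<in> ball 0 1" for w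
    proof -
      have "w * d' w / d w = ((a * cnj l + cnj \<beta> * l) * w + 2 * (a * cnj \<beta>) * w\<^sup>2) /
          (1 + (a * cnj l + cnj \<beta> * l) * w + (a * cnj \<beta>) * w\<^sup>2)"
        by (simp add: d'_def d_def den_def algebra_simps power2_eq_square)
      also have "Re \<dots> < 1"
        using w d0 by (intro quadratic_log_deriv) (auto simp: d_def den_def)
      finally show ?thesis
        by (simp del: times_divide_eq_right)
    qed
  qed (use z in auto)
  show ?thesis
    by (rule that[of S]) (use S pos in \<open>auto simp: weight_def d_def\<close>)
qed

lemma weight_nonzero:
  assumes "norm a \<le> 1" "z \<in> ball 0 1 - {0}"
  shows "weight \<beta> l a z \<noteq> 0"
proof -
  obtain S where "weight \<beta> l a z = z ^ 3 * S z" "Re (S z * (den \<beta> l a z)\<^sup>2) > 0"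
    using weight_starlike[OF assms(1)] assms(2) by (metis Diff_iff)
  then show ?thesis
    using assms(2) by auto
qed

end

text \<open>One step of the Schur algorithm: \<open>\<psi>\<close> is \<open>(g - c) / (1 - cnj c * g)\<close> divided by \<open>z\<close>.\<close>

lemma schur_step:
  assumes hol: "g holomorphic_on ball 0 1" and g: "\<And>z. z \<in> ball 0 1 \<Longrightarrow> norm (g z) \<le> 1"
    and g0: "g 0 = c" and nc: "norm c < 1"
  obtains \<psi> where "\<psi> holomorphic_on ball 0 1" "\<And>z. z \<in> ball 0 1 \<Longrightarrow> norm (\<psi> z) \<le> 1"
    "\<And>z. z \<in> ball 0 1 \<Longrightarrow> g z = \<delta> (\<psi> z * z) c"
    "deriv g 0 = of_real (1 - (norm c)\<^sup>2) * \<psi> 0"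
proof -
  have nz: "1 - cnj c * g z \<noteq> 0" if "z \<in> ball 0 1" for z
    using one_plus_cnj_mult_nonzero[of "g z" "- c"] g[OF that] nc by simp
  define h where "h z = (g z - c) / (1 - cnj c * g z)" for z
  have holh: "h holomorphic_on ball 0 1"
    unfolding h_def using hol nz by (intro holomorphic_intros) auto
  have "h 0 = 0" by (simp add: h_def g0)
  moreover have "norm (h z) \<le> 1" if "z \<in> ball 0 1" for z
    using norm_delta_le_1[of "g z" "- c"] g[OF that] nc by (simp add: h_def \<delta>_def)
  ultimately obtain \<psi> where \<psi>: "\<psi> holomorphic_on ball 0 1" "\<And>z. z \<in> ball 0 1 \<Longrightarrow> h z = z * \<psi> z"
      "\<psi> 0 = deriv h 0" "\<And>z. z \<in> ball 0 1 \<Longrightarrow> norm (\<psi> z) \<le> 1"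
    by (rule holomorphic_divisible_by_z[OF holh, of 1]) auto
  have cc: "1 - cnj c * c \<noteq> 0"
    using nz[of 0] by (simp add: g0)
  have inv: "g z = \<delta> (h z) c" if z: "z \<in> ball 0 1" for z
  proof -
    have "h z + c = (1 - cnj c * c) * g z / (1 - cnj c * g z)"
      "1 + cnj c * h z = (1 - cnj c * c) / (1 - cnj c * g z)"
      using nz[OF z] by (simp_all add: h_def field_simps)
    then show ?thesis
      using nz[OF z] cc by (simp add: \<delta>_def)
  qed
  have "(g has_field_derivative deriv g 0) (at 0)"
    using hol by (intro holomorphic_derivI[where S = "ball 0 1"]) auto
  then have "(h has_field_derivative deriv g 0 / (1 - cnj c * c)) (at 0)"
    unfolding h_def using cc by (auto intro!: derivative_eq_intros simp: g0 power2_eq_square)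
  then have "\<psi> 0 = deriv g 0 / (1 - cnj c * c)"
    using \<psi>(3) DERIV_imp_deriv by metis
  moreover have "1 - cnj c * c = of_real (1 - (norm c)\<^sup>2)"
    by (simp add: complex_norm_square mult.commute del: of_real_power)
  ultimately have "deriv g 0 = of_real (1 - (norm c)\<^sup>2) * \<psi> 0"
    using cc by simp
  moreover have "g z = \<delta> (\<psi> z * z) c" if "z \<in> ball 0 1" for z
    using inv[OF that] \<psi>(2)[OF that] by (simp only: mult.commute)
  ultimately show ?thesis
    using that[OF \<psi>(1,4)] by blast
qed

text \<open>The functions \<open>f'' / M\<close> for \<open>f\<close> in \<open>class_S1 \<alpha> \<beta> M l\<close>, provided
  \<open>0 < M \<le> |\<alpha>|\<close>; see \<open>class_S1D\<close> and \<open>class_S1I\<close>.\<close>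

definition schur_class :: "complex \<Rightarrow> complex \<Rightarrow> (complex \<Rightarrow> complex) set" where
  "schur_class \<beta> l = {g. g holomorphic_on ball 0 1 \<and> (\<forall>z\<in>ball 0 1. norm (g z) \<le> 1) \<and>
     g 0 = \<beta> \<and> deriv g 0 = of_real (1 - (norm \<beta>)\<^sup>2) * l}"

lemma schur_class_parametrized:
  assumes \<beta>: "norm \<beta> < 1" and l: "norm l < 1" and g: "g \<in> schur_class \<beta> l"
  obtains \<phi> where "\<phi> holomorphic_on ball 0 1" "\<And>z. z \<in> ball 0 1 \<Longrightarrow> norm (\<phi> z) \<le> 1"
    "\<And>z. z \<in> ball 0 1 \<Longrightarrow> g z = schur \<beta> l (\<phi> z) z"
proof -
  have g: "g holomorphic_on ball 0 1" "\<And>z. z \<in> ball 0 1 \<Longrightarrow> norm (g z) \<le> 1"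
     "g 0 = \<beta>" "deriv g 0 = of_real (1 - (norm \<beta>)\<^sup>2) * l"
    using g by (auto simp: schur_class_def)
  obtain \<psi> where \<psi>: "\<psi> holomorphic_on ball 0 1" "\<And>z. z \<in> ball 0 1 \<Longrightarrow> norm (\<psi> z) \<le> 1"
    "\<And>z. z \<in> ball 0 1 \<Longrightarrow> g z = \<delta> (\<psi> z * z) \<beta>"
    "deriv g 0 = of_real (1 - (norm \<beta>)\<^sup>2) * \<psi> 0"
    by (rule schur_step[OF g(1) g(2) g(3) \<beta>], assumption, rule that)
  have "of_real (1 - (norm \<beta>)\<^sup>2) \<noteq> (0::complex)"
    using \<beta> abs_square_less_1[of "norm \<beta>"] by (simp del: of_real_diff)
  then have \<psi>0: "\<psi> 0 = l"
    using g(4) \<psi>(4) by simp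
  obtain \<phi> where "\<phi> holomorphic_on ball 0 1" "\<And>z. z \<in> ball 0 1 \<Longrightarrow> norm (\<phi> z) \<le> 1"
    "\<And>z. z \<in> ball 0 1 \<Longrightarrow> \<psi> z = \<delta> (\<phi> z * z) l"
    by (rule schur_step[OF \<psi>(1) \<psi>(2) \<psi>0 l], assumption, rule that)
  then show ?thesis
    using that[of \<phi>] \<psi>(3) by (simp add: schur_def)
qed

lemma schur_mem_class:
  assumes \<beta>: "norm \<beta> \<le> 1" and l: "norm l < 1" and a: "norm a \<le> 1"
  shows "schur \<beta> l a \<in> schur_class \<beta> l"
proof -
  define n where "n z = a * z * (z + \<beta> * cnj l) + (l * z + \<beta>)" for z
  have eq: "schur \<beta> l a z = n z / den \<beta> l a z" if "z \<in> ball 0 1" for z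
    using schur_fraction[OF \<beta> l a that] by (simp add: n_def)
  have "(n has_field_derivative a * \<beta> * cnj l + l) (at 0)"
    unfolding n_def[abs_def] by (auto intro!: derivative_eq_intros)
  moreover have "(den \<beta> l a has_field_derivative a * cnj l + cnj \<beta> * l) (at 0)"
    unfolding den_def[abs_def] by (auto intro!: derivative_eq_intros)
  moreover have [simp]: "den \<beta> l a 0 = 1" "n 0 = \<beta>"
    by (auto simp: den_def n_def)
  ultimately have "((\<lambda>z. n z / den \<beta> l a z) has_field_derivative
      (a * \<beta> * cnj l + l) - \<beta> * (a * cnj l + cnj \<beta> * l)) (at 0)"
    by (auto intro!: derivative_eq_intros)
  then have "(schur \<beta> l a has_field_derivative (a * \<beta> * cnj l + l) - \<beta> * (a * cnj l + cnj \<beta> * l)) (at 0)"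
    by (rule has_field_derivative_transform_within_open[where S = "ball 0 1"]) (auto simp: eq)
  moreover have "(a * \<beta> * cnj l + l) - \<beta> * (a * cnj l + cnj \<beta> * l) = of_real (1 - (norm \<beta>)\<^sup>2) * l"
    by (simp add: complex_norm_square algebra_simps del: of_real_power)
  ultimately have "deriv (schur \<beta> l a) 0 = of_real (1 - (norm \<beta>)\<^sup>2) * l"
    by (metis DERIV_imp_deriv)
  moreover have "schur \<beta> l a 0 = \<beta>"
    by (simp add: schur_def \<delta>_def)
  ultimately show ?thesis
    using holomorphic_schur[OF \<beta> l, of "\<lambda>_. a"] norm_schur[OF \<beta> l a] a
    by (auto simp: schur_class_def)
qed

lemma schur_class_unimodular:
  assumes \<beta>: "norm \<beta> = 1" and g: "g \<in> schur_class \<beta> l" and z: "z \<in> ball 0 1"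
  shows "g z = \<beta>"
proof -
  have "g constant_on ball 0 1"
    by (rule maximum_modulus_principle[of g "ball 0 1" "ball 0 1" 0]) (use g \<beta> in \<open>auto simp: schur_class_def\<close>)
  then show ?thesis
    using g z unfolding constant_on_def schur_class_def by (metis (mono_tags, lifting) centre_in_ball mem_Collect_eq zero_less_one)
qed

section \<open>The extremal inequality\<close>

text \<open>This Moebius function of \<open>v\<close> vanishes at \<open>v = 1\<close> with derivative 1 there, so it maps the closed unit disc to a
  disc that touches the imaginary axis at 0 from the left. Twice its real part, multiplied by \<open>|1 + c v|\<^sup>2\<close>, is
  \<open>- (1 - |c|\<^sup>2) |1 - v|\<^sup>2 - (1 - |v|\<^sup>2) |1 + c|\<^sup>2\<close>.\<close>

lemma Re_tangent_half_plane:
  fixes c v :: complex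
  assumes "norm c < 1" "norm v \<le> 1" "v \<noteq> 1"
  shows "Re ((v - 1) * (1 + c) / (1 + c * v)) < 0"
proof -
  have c1: "(Re c)\<^sup>2 + (Im c)\<^sup>2 < 1" and v1: "(Re v)\<^sup>2 + (Im v)\<^sup>2 \<le> 1"
    using assms by (auto simp: cmod_def)
  have "1 + c * v \<noteq> 0"
    using one_plus_cnj_mult_nonzero[of v "cnj c"] assms by simp
  then have n: "(norm (1 + c * v))\<^sup>2 > 0"
    by simp
  have "2 * Re ((v - 1) * (1 + c) * cnj (1 + c * v)) =
      - (1 - (norm c)\<^sup>2) * (norm (1 - v))\<^sup>2 - (1 - (norm v)\<^sup>2) * (norm (1 + c))\<^sup>2"
    unfolding cmod_power2 by (simp, algebra)
  also have "\<dots> < 0"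
  proof -
    have "(1 - (norm c)\<^sup>2) * (norm (1 - v))\<^sup>2 > 0"
      using assms by (intro mult_pos_pos) (auto simp: abs_square_less_1)
    moreover have "(1 - (norm v)\<^sup>2) * (norm (1 + c))\<^sup>2 \<ge> 0"
      using assms by (intro mult_nonneg_nonneg) (auto simp: power_le_one)
    ultimately show ?thesis
      by linarith
  qed
  finally have "Re ((v - 1) * (1 + c) * cnj (1 + c * v)) < 0"
    by simp
  moreover have "Re ((v - 1) * (1 + c) / (1 + c * v)) =
      Re ((v - 1) * (1 + c) * cnj (1 + c * v)) / (norm (1 + c * v))\<^sup>2"
    by (subst complex_div_cnj) (metis Re_divide_of_real)
  ultimately show ?thesis
    using n by (simp add: divide_neg_pos)
qed

text \<open>Libera's lemma for \<open>G = weight \<beta> l a\<close> and \<open>H\<close> the primitive of the difference of the two integrands: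
  up to a positive factor, \<open>H'/(a G')\<close> is \<open>(\<phi>/a - 1) d\<^sub>a / d\<^sub>\<phi>\<close>, whose real part is negative by
  \<open>Re_tangent_half_plane\<close>.\<close>

lemma deviation_half_plane:
  assumes \<beta>: "norm \<beta> < 1" and l: "norm l < 1" and a: "norm a = 1"
    and hol: "\<phi> holomorphic_on ball 0 1" and \<phi>: "\<And>z. z \<in> ball 0 1 \<Longrightarrow> norm (\<phi> z) \<le> 1"
    and ne: "\<And>z. z \<in> ball 0 1 \<Longrightarrow> \<phi> z \<noteq> a"
    and z0: "z0 \<in> ball 0 1 - {0}"
  shows "Re ((prim (\<lambda>z. schur \<beta> l (\<phi> z) z) z0 - prim (schur \<beta> l a) z0) / (a * weight \<beta> l a z0)) < 0"
proof -
  have \<beta>': "norm \<beta> \<le> 1" and a': "norm a \<le> 1" and [simp]: "a \<noteq> 0"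
    using \<beta> a by auto
  note nz = den_nonzero[OF \<beta>' l]
  define K where "K = (1 - (norm \<beta>)\<^sup>2) * (1 - (norm l)\<^sup>2)"
  have K: "K > 0"
    unfolding K_def using \<beta> l by (intro mult_pos_pos) (auto simp: abs_square_less_1)
  define d where "d = den \<beta> l a"
  define e where "e z = den \<beta> l (\<phi> z) z" for z
  have d0: "d z \<noteq> 0" and e0: "e z \<noteq> 0" if "z \<in> ball 0 1" for z
    using nz[OF a' that] nz[OF \<phi>[OF that] that] by (auto simp: d_def e_def)
  have hold: "d holomorphic_on ball 0 1" and hole: "e holomorphic_on ball 0 1"
    using holomorphic_den[of "\<lambda>_. a"] holomorphic_den[OF hol] by (auto simp: d_def e_def[abs_def])
  obtain S where S: "S holomorphic_on ball 0 1"
    "\<And>z. z \<in> ball 0 1 \<Longrightarrow> weight \<beta> l a z = z ^ 3 * S z"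
    "\<And>z. z \<in> ball 0 1 \<Longrightarrow> 3 * S z + z * deriv S z = 1 / (d z)\<^sup>2"
    "\<And>z. z \<in> ball 0 1 \<Longrightarrow> Re (S z * (d z)\<^sup>2) > 0"
    using weight_starlike[OF \<beta>' l a'] unfolding d_def by blast
  have S0: "S z \<noteq> 0" if "z \<in> ball 0 1" for z
    using S(4)[OF that] by auto
  define q where "q z = (\<phi> z / a - 1) * d z / e z" for z
  have holq: "q holomorphic_on ball 0 1"
    unfolding q_def using hold hole hol e0 by (intro holomorphic_intros) auto
  have Req: "Re (q z) < 0" if z: "z \<in> ball 0 1" for z
  proof -
    define P where "P = (cnj l + cnj \<beta> * z) * z"
    define R where "R = 1 + cnj \<beta> * l * z"
    have den: "den \<beta> l w z = P * w + R" for w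
      by (simp add: den_def P_def R_def algebra_simps power2_eq_square)
    \<comment> \<open>\<open>P * w + R\<close> has no zero in the closed unit disc of \<open>w\<close>, so its zero \<open>- R / P\<close> lies outside.\<close>
    have PR: "norm P < norm R"
    proof (rule ccontr)
      assume "\<not> norm P < norm R"
      moreover have "R \<noteq> 0"
        using nz[of 0 z] z den[of 0] by auto
      ultimately have "P \<noteq> 0" "norm (- R / P) \<le> 1"
        by (auto simp: norm_divide divide_le_eq_1)
      then show False
        using nz[of "- R / P" z] z by (auto simp: den)
    qed
    then have R: "R \<noteq> 0" by auto
    \<comment> \<open>Normalized with \<open>c = P * a / R\<close> and \<open>v = \<phi> z / a\<close>, so that \<open>w = a\<close> becomes \<open>v = 1\<close>.\<close>
    have "Re ((\<phi> z / a - 1) * (1 + P * a / R) / (1 + P * a / R * (\<phi> z / a))) < 0"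
      by (rule Re_tangent_half_plane)
        (use PR R a \<phi>[OF z] ne[OF z] in \<open>auto simp: norm_divide norm_mult\<close>)
    also have "(\<phi> z / a - 1) * (1 + P * a / R) / (1 + P * a / R * (\<phi> z / a)) = q z"
    proof -
      have "1 + P * a / R = d z / R" "1 + P * a / R * (\<phi> z / a) = e z / R"
        using R by (simp_all add: d_def e_def den field_simps)
      then show ?thesis
        using R by (simp add: q_def)
    qed
    finally show ?thesis .
  qed
  have "(\<lambda>z. q z / (d z)\<^sup>2) holomorphic_on ball 0 1"
    using holq hold d0 by (intro holomorphic_intros) auto
  then obtain H where H: "H holomorphic_on ball 0 1"
      "\<And>z. z \<in> ball 0 1 \<Longrightarrow> prim (\<lambda>z. z ^ 2 * (q z / (d z)\<^sup>2)) z = z ^ 3 * H z"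
      "\<And>z. z \<in> ball 0 1 \<Longrightarrow> 3 * H z + z * deriv H z = q z / (d z)\<^sup>2"
    by (rule prim_power_mult[where n = 2]) (auto simp: numeral_3_eq_3)
  have neg: "Re (H z0 / S z0) < 0"
  proof (rule Re_neg_subordination[where p = "\<lambda>z. H z / S z" and t = "\<lambda>z. S z * (d z)\<^sup>2" and q = q])
    show "(\<lambda>z. H z / S z) holomorphic_on ball 0 1"
      using H(1) S(1) S0 by (intro holomorphic_intros) auto
    show "H z / S z + z * deriv (\<lambda>z. H z / S z) z * (S z * (d z)\<^sup>2) = q z" if z: "z \<in> ball 0 1" for z
    proof -
      have "deriv (\<lambda>z. H z / S z) z = (deriv H z * S z - H z * deriv S z) / (S z)\<^sup>2"
        using H(1) S(1) S0 z
        by (intro deriv_divide) (auto intro!: holomorphic_on_imp_differentiable_at[of _ "ball 0 1"])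
      then have "z * deriv (\<lambda>z. H z / S z) z = ((z * deriv H z) * S z - H z * (z * deriv S z)) / (S z)\<^sup>2"
        by (simp add: algebra_simps)
      also have "z * deriv H z = q z / (d z)\<^sup>2 - 3 * H z"
        using H(3)[OF z] by (simp add: eq_diff_eq add.commute)
      also have "z * deriv S z = 1 / (d z)\<^sup>2 - 3 * S z"
        using S(3)[OF z] by (simp add: eq_diff_eq add.commute)
      finally have e: "z * deriv (\<lambda>z. H z / S z) z =
        ((q z / (d z)\<^sup>2 - 3 * H z) * S z - H z * (1 / (d z)\<^sup>2 - 3 * S z)) / (S z)\<^sup>2" .
      show ?thesis
        unfolding e using S0[OF z] d0[OF z] by (simp add: field_simps power2_eq_square)
    qed
  qed (use S(4) Req z0 in auto)
  have "prim (\<lambda>z. schur \<beta> l (\<phi> z) z) z0 - prim (schur \<beta> l a) z0 =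
      prim (\<lambda>z. schur \<beta> l (\<phi> z) z - schur \<beta> l a z) z0"
    using prim_linear[OF holomorphic_schur[OF \<beta>' l hol \<phi>] holomorphic_schur[OF \<beta>' l, of "\<lambda>_. a"], of z0 1 "-1"]
      z0 a' by simp
  also have "\<dots> = prim (\<lambda>z. of_real K * a * (z ^ 2 * (q z / (d z)\<^sup>2))) z0"
  proof (rule prim_cong)
    fix z :: complex assume z: "z \<in> ball 0 1"
    show "schur \<beta> l (\<phi> z) z - schur \<beta> l a z = of_real K * a * (z ^ 2 * (q z / (d z)\<^sup>2))"
      using d0[OF z] e0[OF z] unfolding schur_diff[OF \<beta>' l \<phi>[OF z] a' z]
      by (simp add: q_def flip: K_def d_def e_def) (simp add: field_simps power2_eq_square)
  qed (use z0 in auto)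
  also have "\<dots> = of_real K * a * (z0 ^ 3 * H z0)"
  proof -
    have hk: "(\<lambda>z. z ^ 2 * (q z / (d z)\<^sup>2)) holomorphic_on ball 0 1"
      using holq hold d0 by (intro holomorphic_intros) auto
    have z0': "z0 \<in> ball 0 1"
      using z0 by auto
    show ?thesis
      unfolding prim_cmult[OF hk z0'] H(2)[OF z0'] by simp
  qed
  finally have "(prim (\<lambda>z. schur \<beta> l (\<phi> z) z) z0 - prim (schur \<beta> l a) z0) / (a * weight \<beta> l a z0) =
      of_real K * (H z0 / S z0)"
    using S(2)[of z0] z0 by simp
  moreover have "Re (of_real K * w) = K * Re w" for w
    by simp
  ultimately show ?thesis
    using K neg by (simp add: mult_pos_neg del: times_divide_eq_right)
qed

text \<open>If \<open>\<phi>\<close> takes the unimodular value \<open>a\<close> inside the disc, the maximum principle makes it constant; otherwise the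
  strict inequality of \<open>deviation_half_plane\<close> applies.\<close>

lemma schur_class_extremal:
  assumes \<beta>: "norm \<beta> < 1" and l: "norm l < 1" and a: "norm a = 1" and z0: "z0 \<in> ball 0 1 - {0}"
    and g: "g \<in> schur_class \<beta> l"
  shows "(\<forall>z\<in>ball 0 1. g z = schur \<beta> l a z) \<or>
    Re ((prim g z0 - prim (schur \<beta> l a) z0) / (a * weight \<beta> l a z0)) < 0"
proof -
  obtain \<phi> where \<phi>: "\<phi> holomorphic_on ball 0 1" "\<And>z. z \<in> ball 0 1 \<Longrightarrow> norm (\<phi> z) \<le> 1"
    "\<And>z. z \<in> ball 0 1 \<Longrightarrow> g z = schur \<beta> l (\<phi> z) z"
    by (rule schur_class_parametrized[OF \<beta> l g], rule that)
  show ?thesis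
  proof (cases "\<exists>w\<in>ball 0 1. \<phi> w = a")
    case True
    then obtain w where w: "w \<in> ball 0 1" "\<phi> w = a"
      by blast
    have "\<phi> constant_on ball 0 1"
      by (rule maximum_modulus_principle[OF \<phi>(1), of "ball 0 1" w]) (use w \<phi>(2) a in auto)
    then have "\<phi> z = a" if "z \<in> ball 0 1" for z
      using w that unfolding constant_on_def by metis
    then show ?thesis
      using \<phi>(3) by simp
  next
    case False
    have "prim g z0 = prim (\<lambda>z. schur \<beta> l (\<phi> z) z) z0"
      using \<phi>(3) z0 by (intro prim_cong) auto
    then show ?thesis
      using deviation_half_plane[OF \<beta> l a \<phi>(1,2) _ z0] False by auto
  qed
qed

section \<open>Reduction of the univalent class to bounded functions\<close>

text \<open>The Noshiro--Warschawski criterion: along a segment from \<open>a\<close> to \<open>b\<close>, the real part of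
  \<open>c * f / (b - a)\<close> is strictly increasing.\<close>

lemma inj_on_if_Re_deriv_pos:
  assumes S: "convex S" "open S" and hol: "f holomorphic_on S"
    and pos: "\<And>z. z \<in> S \<Longrightarrow> Re (c * deriv f z) > 0"
  shows "inj_on f S"
proof (rule inj_onI, rule ccontr)
  fix a b assume ab: "a \<in> S" "b \<in> S" "f a = f b" "a \<noteq> b"
  define h where "h t = Re (c * f (a + of_real t * (b - a)) / (b - a))" for t :: real
  have "h 0 < h 1"
  proof (rule DERIV_pos_imp_increasing[of 0 1 h])
    fix t :: real assume t: "0 \<le> t" "t \<le> 1"
    define z where "z = a + of_real t * (b - a)"
    have "z = (1 - t) *\<^sub>R a + t *\<^sub>R b"
      by (simp add: z_def scaleR_conv_of_real algebra_simps)
    then have z: "z \<in> S"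
      using S(1) ab(1,2) t by (simp add: convexD_alt)
    have "(f has_field_derivative deriv f z) (at z)"
      using hol z S by (intro holomorphic_derivI)
    then have "((\<lambda>t::complex. f (a + t * (b - a))) has_field_derivative deriv f z * (b - a)) (at (of_real t))"
      by (intro DERIV_chain2[of f _ "\<lambda>t. a + t * (b - a)"]) (auto intro!: derivative_eq_intros simp: z_def)
    then have "((\<lambda>t::complex. c * f (a + t * (b - a)) / (b - a)) has_field_derivative
        c * (deriv f z * (b - a)) / (b - a)) (at (of_real t))"
      by (intro DERIV_cdivide DERIV_cmult)
    then have "(h has_real_derivative Re (c * deriv f z)) (at t)"
      unfolding h_def using ab(4)
      by (intro has_field_derivative_Re has_vector_derivative_real_field) simp
    then show "\<exists>y. (h has_real_derivative y) (at t) \<and> 0 < y"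
      using pos[OF z] by blast
  qed simp
  then show False
    using ab(3) by (simp add: h_def)
qed

text \<open>Dividing the bounded function \<open>z f''(z)\<close> by \<open>z\<close> removes the factor \<open>z\<close> from the bound, including at 0.\<close>

lemma class_S1D:
  assumes M: "0 < M" and f: "f \<in> class_S1 \<alpha> \<beta> M l"
  obtains g where "g \<in> schur_class \<beta> l" "f holomorphic_on ball 0 1" "f 0 = 0"
    "\<And>z. z \<in> ball 0 1 \<Longrightarrow> deriv f z = \<alpha> + of_real M * prim g z"
proof -
  have hol: "f holomorphic_on ball 0 1" and f0: "f 0 = 0" "deriv f 0 = \<alpha>"
    and f2: "deriv (deriv f) 0 = of_real M * \<beta>"
    and f3: "deriv (deriv (deriv f)) 0 = of_real (M * (1 - (norm \<beta>)\<^sup>2)) * l"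
    and bound: "\<And>z. z \<in> ball 0 1 \<Longrightarrow> norm (z * deriv (deriv f) z) \<le> M"
    using f by (auto simp: class_S1_def class_B_def eval_nat_numeral)
  have hol1: "deriv f holomorphic_on ball 0 1"
    using hol by (intro holomorphic_deriv) auto
  then have hol2: "deriv (deriv f) holomorphic_on ball 0 1"
    by (rule holomorphic_deriv) auto
  define k where "k z = z * deriv (deriv f) z" for z
  have "k holomorphic_on ball 0 1" "k 0 = 0" "\<And>z. z \<in> ball 0 1 \<Longrightarrow> norm (k z) \<le> M"
    unfolding k_def using bound by (auto intro!: holomorphic_on_mult[OF holomorphic_on_ident hol2])
  note k = this
  obtain h where h: "\<And>z. z \<in> ball 0 1 \<Longrightarrow> k z = z * h z" "h 0 = deriv k 0"
      "\<And>z. z \<in> ball 0 1 \<Longrightarrow> norm (h z) \<le> M"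
    by (rule holomorphic_divisible_by_z[OF k(1) k(2) k(3)], assumption, rule that)
  have "(deriv (deriv f) has_field_derivative deriv (deriv (deriv f)) 0) (at 0)"
    using hol2 by (intro holomorphic_derivI[where S = "ball 0 1"]) auto
  then have "(k has_field_derivative deriv (deriv f) 0) (at 0)"
    unfolding k_def by (auto intro!: derivative_eq_intros)
  then have "h z = deriv (deriv f) z" if "z \<in> ball 0 1" for z
    using h(1)[OF that] h(2) by (cases "z = 0") (auto simp: k_def DERIV_imp_deriv)
  then have bound2: "norm (deriv (deriv f) z) \<le> M" if "z \<in> ball 0 1" for z
    using h(3) that by metis
  define g where "g z = deriv (deriv f) z / of_real M" for z
  have "g holomorphic_on ball 0 1"
    unfolding g_def using M by (intro holomorphic_on_divide hol2 holomorphic_on_const) auto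
  moreover have "norm (g z) \<le> 1" if "z \<in> ball 0 1" for z
    using bound2[OF that] M by (simp add: g_def norm_divide)
  moreover have "deriv g 0 = of_real (1 - (norm \<beta>)\<^sup>2) * l"
  proof -
    have "deriv g 0 = deriv (deriv (deriv f)) 0 / of_real M"
      unfolding g_def using hol2 by (intro deriv_cdivide_right) (simp add: holomorphic_on_imp_differentiable_at)
    then show ?thesis
      using M by (simp add: f3)
  qed
  ultimately have "g \<in> schur_class \<beta> l"
    using f2 M by (simp add: schur_class_def g_def)
  moreover have "deriv f z = \<alpha> + of_real M * prim g z" if z: "z \<in> ball 0 1" for z
  proof -
    have "((\<lambda>z. deriv f z / of_real M) has_field_derivative g w) (at w)" if "w \<in> ball 0 1" for w
      unfolding g_def using hol1 that
      by (intro DERIV_cdivide holomorphic_derivI[where S = "ball 0 1"]) auto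
    from prim_eq[OF this z] show ?thesis
      using M f0 by (simp add: field_simps)
  qed
  ultimately show ?thesis
    using that hol f0 by blast
qed

text \<open>The values of \<open>f'\<close> stay in the disc around \<open>\<alpha>\<close> of radius \<open>M * |z| < |\<alpha>|\<close>, hence \<open>cnj \<alpha> * f'\<close> has positive
  real part and \<open>f\<close> is injective.\<close>

lemma class_S1I:
  assumes M: "0 < M" "M \<le> norm \<alpha>" and g: "g \<in> schur_class \<beta> l"
    and hol: "f holomorphic_on ball 0 1" and f0: "f 0 = 0"
    and df: "\<And>z. z \<in> ball 0 1 \<Longrightarrow> deriv f z = \<alpha> + of_real M * prim g z"
  shows "f \<in> class_S1 \<alpha> \<beta> M l"
proof -
  have g: "g holomorphic_on ball 0 1" "\<And>z. z \<in> ball 0 1 \<Longrightarrow> norm (g z) \<le> 1"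
     "g 0 = \<beta>" "deriv g 0 = of_real (1 - (norm \<beta>)\<^sup>2) * l"
    using g by (auto simp: schur_class_def)
  have d2: "deriv (deriv f) z = of_real M * g z" if z: "z \<in> ball 0 1" for z
  proof -
    have "((\<lambda>z. \<alpha> + of_real M * prim g z) has_field_derivative of_real M * g z) (at z)"
      using has_field_derivative_prim[OF g(1) z] by (auto intro!: derivative_eq_intros)
    then have "(deriv f has_field_derivative of_real M * g z) (at z)"
      by (rule has_field_derivative_transform_within_open[where S = "ball 0 1"]) (use z df in auto)
    then show ?thesis
      by (rule DERIV_imp_deriv)
  qed
  have "(g has_field_derivative deriv g 0) (at 0)"
    using g(1) by (intro holomorphic_derivI[where S = "ball 0 1"]) auto
  then have "((\<lambda>z. of_real M * g z) has_field_derivative of_real M * deriv g 0) (at 0)"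
    by (rule DERIV_cmult)
  then have "(deriv (deriv f) has_field_derivative of_real M * deriv g 0) (at 0)"
    by (rule has_field_derivative_transform_within_open[where S = "ball 0 1"]) (use d2 in auto)
  then have d3: "deriv (deriv (deriv f)) 0 = of_real M * deriv g 0"
    by (rule DERIV_imp_deriv)
  have "inj_on f (ball 0 1)"
  proof (rule inj_on_if_Re_deriv_pos[OF convex_ball open_ball hol])
    fix z :: complex assume z: "z \<in> ball 0 1"
    have "norm (prim g z) < 1"
      using norm_prim_le[OF g(1,2) z] z by simp
    then have "M * norm (prim g z) < norm \<alpha>"
      using M by (smt (verit) mult_less_cancel_left2)
    moreover have "norm \<alpha> > 0"
      using M by linarith
    ultimately have "norm (cnj \<alpha> * (of_real M * prim g z)) < norm \<alpha> * norm \<alpha>"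
      using M by (simp add: norm_mult del: zero_less_norm_iff)
    moreover have "norm \<alpha> * norm \<alpha> = Re (cnj \<alpha> * \<alpha>)"
      by (simp add: cmod_def flip: power2_eq_square)
    ultimately have "Re (cnj \<alpha> * \<alpha>) + Re (cnj \<alpha> * (of_real M * prim g z)) > 0"
      using abs_Re_le_cmod[of "cnj \<alpha> * (of_real M * prim g z)"] by linarith
    then show "Re (cnj \<alpha> * deriv f z) > 0"
      unfolding df[OF z] by (simp add: distrib_left)
  qed
  moreover have "norm (z * deriv (deriv f) z) \<le> M" if z: "z \<in> ball 0 1" for z
  proof -
    have "norm z * norm (g z) \<le> 1"
      using z g(2)[OF z] by (intro mult_le_one) auto
    then show ?thesis
      using d2[OF z] M by (simp add: norm_mult mult.left_commute mult_left_le)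
  qed
  ultimately show ?thesis
    using hol f0 df[of 0] d2[of 0] d3 g(3,4)
    by (auto simp: class_S1_def class_B_def eval_nat_numeral)
qed

section \<open>Convexity and closedness of the region of variability\<close>

lemma V1_eq_schur_values:
  assumes M: "0 < M" "M \<le> norm \<alpha>" and z0: "z0 \<in> ball 0 1"
  shows "V1 \<alpha> \<beta> M z0 l = (\<lambda>g. \<alpha> + of_real M * prim g z0) ` schur_class \<beta> l"
proof (intro equalityI subsetI)
  fix w assume "w \<in> V1 \<alpha> \<beta> M z0 l"
  then obtain f where f: "f \<in> class_S1 \<alpha> \<beta> M l" "w = deriv f z0"
    by (auto simp: V1_def)
  obtain g where "g \<in> schur_class \<beta> l" "deriv f z0 = \<alpha> + of_real M * prim g z0"
    using class_S1D[OF M(1) f(1)] z0 by metis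
  then show "w \<in> (\<lambda>g. \<alpha> + of_real M * prim g z0) ` schur_class \<beta> l"
    using f(2) by blast
next
  fix w assume "w \<in> (\<lambda>g. \<alpha> + of_real M * prim g z0) ` schur_class \<beta> l"
  then obtain g where g: "g \<in> schur_class \<beta> l" "w = \<alpha> + of_real M * prim g z0"
    by blast
  define h where "h z = \<alpha> + of_real M * prim g z" for z
  have "prim g holomorphic_on ball 0 1"
    using g(1) by (intro holomorphic_prim) (auto simp: schur_class_def)
  then have h: "h holomorphic_on ball 0 1"
    unfolding h_def by (intro holomorphic_intros)
  have "prim h \<in> class_S1 \<alpha> \<beta> M l"
    using class_S1I[OF M g(1) holomorphic_prim[OF h]] deriv_prim[OF h] by (simp add: h_def)
  moreover have "deriv (prim h) z0 = w"
    using deriv_prim[OF h z0] g(2) by (simp add: h_def)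
  ultimately show "w \<in> V1 \<alpha> \<beta> M z0 l"
    by (auto simp: V1_def)
qed

lemma convex_V1:
  assumes M: "0 < M" "M \<le> norm \<alpha>" and z0: "z0 \<in> ball 0 1"
  shows "convex (V1 \<alpha> \<beta> M z0 l)"
  unfolding V1_eq_schur_values[OF assms]
proof (rule convexI)
  fix x y and u v :: real
  assume "x \<in> (\<lambda>g. \<alpha> + of_real M * prim g z0) ` schur_class \<beta> l"
    and "y \<in> (\<lambda>g. \<alpha> + of_real M * prim g z0) ` schur_class \<beta> l"
    and uv: "0 \<le> u" "0 \<le> v" "u + v = 1"
  then obtain f g where f: "f \<in> schur_class \<beta> l" "x = \<alpha> + of_real M * prim f z0"
    and g: "g \<in> schur_class \<beta> l" "y = \<alpha> + of_real M * prim g z0"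
    by auto
  define h where "h z = of_real u * f z + of_real v * g z" for z
  have holf: "f holomorphic_on ball 0 1" and holg: "g holomorphic_on ball 0 1"
    using f(1) g(1) by (auto simp: schur_class_def)
  have uv': "of_real u + of_real v = (1 :: complex)"
    using uv(3) by (metis of_real_1 of_real_add)
  have "h holomorphic_on ball 0 1"
    unfolding h_def using holf holg by (intro holomorphic_intros)
  moreover have "norm (h z) \<le> 1" if "z \<in> ball 0 1" for z
  proof -
    have "norm (h z) \<le> u * norm (f z) + v * norm (g z)"
      unfolding h_def using uv norm_triangle_ineq[of "of_real u * f z" "of_real v * g z"]
      by (simp add: norm_mult)
    also have "\<dots> \<le> u * 1 + v * 1"
      using f(1) g(1) uv that by (intro add_mono mult_left_mono) (auto simp: schur_class_def)
    finally show ?thesis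
      using uv by simp
  qed
  moreover have "h 0 = \<beta>"
    using f(1) g(1) uv' by (simp add: h_def schur_class_def flip: distrib_right)
  moreover have "deriv h 0 = of_real (1 - (norm \<beta>)\<^sup>2) * l"
  proof -
    have "(f has_field_derivative of_real (1 - (norm \<beta>)\<^sup>2) * l) (at 0)"
      "(g has_field_derivative of_real (1 - (norm \<beta>)\<^sup>2) * l) (at 0)"
      using holomorphic_derivI[OF holf, of 0] holomorphic_derivI[OF holg, of 0] f(1) g(1)
      by (auto simp: schur_class_def)
    then have "(h has_field_derivative of_real u * (of_real (1 - (norm \<beta>)\<^sup>2) * l) +
        of_real v * (of_real (1 - (norm \<beta>)\<^sup>2) * l)) (at 0)"
      unfolding h_def by (intro DERIV_add DERIV_cmult)
    then show ?thesis
      using uv' by (simp add: DERIV_imp_deriv flip: distrib_right)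
  qed
  ultimately have "h \<in> schur_class \<beta> l"
    by (simp add: schur_class_def)
  moreover have "u *\<^sub>R x + v *\<^sub>R y = \<alpha> + of_real M * prim h z0"
  proof -
    have "u *\<^sub>R x + v *\<^sub>R y = (of_real u + of_real v) * \<alpha> +
        of_real M * (of_real u * prim f z0 + of_real v * prim g z0)"
      by (simp add: f g scaleR_conv_of_real algebra_simps)
    then show ?thesis
      unfolding h_def[abs_def] prim_linear[OF holf holg z0] uv' by simp
  qed
  ultimately show "u *\<^sub>R x + v *\<^sub>R y \<in> (\<lambda>g. \<alpha> + of_real M * prim g z0) ` schur_class \<beta> l"
    by blast
qed

text \<open>Montel's theorem. Locally uniform convergence carries the bound, the two conditions at 0 and the integrals
  over to the limit.\<close>

lemma schur_class_sequentially_compact: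
  assumes g: "\<And>n. g n \<in> schur_class \<beta> l"
  obtains h r where "h \<in> schur_class \<beta> l" "strict_mono (r :: nat \<Rightarrow> nat)"
    "\<And>z. z \<in> ball 0 1 \<Longrightarrow> (\<lambda>n. prim (g (r n)) z) \<longlonglongrightarrow> prim h z"
proof -
  define H where "H = {h. h holomorphic_on ball (0::complex) 1 \<and> (\<forall>z\<in>ball 0 1. norm (h z) \<le> (1::real))}"
  have gH: "range g \<subseteq> H"
    using g by (auto simp: H_def schur_class_def)
  obtain h r where h: "h holomorphic_on ball 0 1" "strict_mono (r :: nat \<Rightarrow> nat)"
    "\<And>x. x \<in> ball 0 1 \<Longrightarrow> ((\<lambda>n. g (r n) x) \<longlongrightarrow> h x) sequentially"
    "\<And>K. \<lbrakk>compact K; K \<subseteq> ball 0 1\<rbrakk> \<Longrightarrow> uniform_limit K (g \<circ> r) h sequentially"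
    by (rule Montel[of "ball 0 1" H g]) (use gH in \<open>auto simp: H_def intro!: exI[of _ 1]\<close>)
  have holg: "g n holomorphic_on ball 0 1" for n
    using g[of n] by (simp add: schur_class_def)
  have "norm (h z) \<le> 1" if z: "z \<in> ball 0 1" for z
    by (rule Lim_norm_ubound[OF _ h(3)[OF z]]) (use g z in \<open>auto simp: schur_class_def\<close>)
  moreover have "h 0 = \<beta>"
  proof -
    have "(\<lambda>n. g (r n) 0) = (\<lambda>n. \<beta>)"
      using g by (auto simp: schur_class_def)
    then show ?thesis
      using h(3)[of 0] by (simp add: LIMSEQ_const_iff)
  qed
  moreover have "deriv h 0 = of_real (1 - (norm \<beta>)\<^sup>2) * l"
  proof -
    have "uniform_limit (cball 0 (1/2)) (g \<circ> r) h sequentially"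
      by (rule h(4)) auto
    then have "uniform_limit (ball 0 (1/2)) (g \<circ> r) h sequentially"
      by (rule uniform_limit_on_subset) auto
    moreover have "eventually (\<lambda>n. (g \<circ> r) n holomorphic_on ball 0 (1/2)) sequentially"
      using holomorphic_on_subset[OF holg subset_ball[of "1/2" 1]] by simp
    ultimately have "((\<lambda>n. (deriv ^^ 1) ((g \<circ> r) n) 0) \<longlongrightarrow> (deriv ^^ 1) h 0) sequentially"
      by (rule higher_deriv_complex_uniform_limit) simp_all
    moreover have "(\<lambda>n. (deriv ^^ 1) ((g \<circ> r) n) 0) = (\<lambda>n. of_real (1 - (norm \<beta>)\<^sup>2) * l)"
      using g by (auto simp: schur_class_def)
    ultimately show ?thesis
      by (simp add: LIMSEQ_const_iff)
  qed
  ultimately have "h \<in> schur_class \<beta> l"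
    using h(1) by (simp add: schur_class_def)
  moreover have "(\<lambda>n. prim (g (r n)) z) \<longlonglongrightarrow> prim h z" if z: "z \<in> ball 0 1" for z
  proof -
    have seg: "closed_segment 0 z \<subseteq> ball 0 1"
      using z by (simp add: closed_segment_subset)
    have "uniform_limit (path_image (linepath 0 z)) (g \<circ> r) h sequentially"
      using h(4)[OF compact_segment seg] by (simp del: linepath_0)
    moreover have "(g \<circ> r) n contour_integrable_on linepath 0 z" for n
      using holomorphic_on_imp_continuous_on[OF holomorphic_on_subset[OF holg seg]]
      by (simp add: contour_integrable_continuous_linepath del: linepath_0)
    ultimately show ?thesis
      unfolding prim_def
      using contour_integral_uniform_limit(2)[of "g \<circ> r" "linepath 0 z" sequentially h "norm z"]
      by (simp add: o_def del: linepath_0)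
  qed
  ultimately show ?thesis
    using that h(2) by blast
qed

lemma closed_V1:
  assumes M: "0 < M" "M \<le> norm \<alpha>" and z0: "z0 \<in> ball 0 1"
  shows "closed (V1 \<alpha> \<beta> M z0 l)"
  unfolding closed_sequential_limits
proof (intro allI impI, elim conjE)
  fix x w assume "\<forall>n. x n \<in> V1 \<alpha> \<beta> M z0 l" and lim: "x \<longlonglongrightarrow> w"
  then obtain g where g: "\<And>n. g n \<in> schur_class \<beta> l" "\<And>n. x n = \<alpha> + of_real M * prim (g n) z0"
    unfolding V1_eq_schur_values[OF assms] image_iff by metis
  obtain h r where h: "h \<in> schur_class \<beta> l" "strict_mono (r :: nat \<Rightarrow> nat)"
    "(\<lambda>n. prim (g (r n)) z0) \<longlonglongrightarrow> prim h z0"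
    using schur_class_sequentially_compact[of g, OF g(1)] z0 by metis
  have "(\<lambda>n. x (r n)) \<longlonglongrightarrow> \<alpha> + of_real M * prim h z0"
    unfolding g(2) by (intro tendsto_intros h(3))
  moreover have "(\<lambda>n. x (r n)) \<longlonglongrightarrow> w"
    using LIMSEQ_subseq_LIMSEQ[OF lim h(2)] by (simp add: o_def)
  ultimately have "w = \<alpha> + of_real M * prim h z0"
    using LIMSEQ_unique by blast
  then show "w \<in> V1 \<alpha> \<beta> M z0 l"
    unfolding V1_eq_schur_values[OF assms] using h(1) by blast
qed

section \<open>Outer normals and supporting lines\<close>

lemma cis_minus_pi: "cis (- pi) = - 1"
  by (simp add: complex_eq_iff)

lemma cis_eq_cisD:
  assumes "-pi \<le> s" "s \<le> pi" "-pi \<le> t" "t \<le> pi" "cis s = cis t"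
  shows "s = t \<or> s = -pi \<and> t = pi \<or> s = pi \<and> t = -pi"
proof -
  have A: "Arg (cis x) = (if x = -pi then pi else x)" if "-pi \<le> x" "x \<le> pi" for x
  proof (cases "x = - pi")
    case True
    then have "cis x = cis pi"
      by (simp only: cis_minus_pi cis_pi)
    then show ?thesis
      using True Arg_cis[of pi] by (simp del: cis_pi)
  next
    case False
    then have "- pi < x"
      using that(1) by linarith
    then show ?thesis
      using False Arg_cis that(2) by simp
  qed
  have "(if s = -pi then pi else s) = (if t = -pi then pi else t)"
    using A[OF assms(1,2)] A[OF assms(3,4)] unfolding assms(5) by metis
  then show ?thesis
    by (metis (full_types))
qed

lemma continuous_on_prim_param:
  assumes cont: "continuous_on (A \<times> ball 0 1) (\<lambda>(a, z). h a z)" and z0: "z0 \<in> ball 0 1"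
  shows "continuous_on A (\<lambda>a. prim (h a) z0)"
proof -
  have eq: "prim (h a) z0 = integral (cbox 0 1) (\<lambda>t. h a (of_real t * z0) * z0)" for a
    unfolding prim_def contour_integral_integral
    by (simp add: vector_derivative_linepath_at scaleR_conv_of_real)
  have "of_real t * z0 \<in> ball 0 1" if "t \<in> cbox 0 (1::real)" for t
    using that z0 mult_left_le_one_le[of "norm z0" t] by (auto simp: norm_mult)
  then have "continuous_on (A \<times> cbox 0 1) (\<lambda>x. (\<lambda>(a, z). h a z) (fst x, of_real (snd x) * z0))"
    by (intro continuous_on_compose2[OF cont] continuous_intros) auto
  then have "continuous_on (A \<times> cbox 0 1) (\<lambda>(a, t). h a (of_real t * z0) * z0)"
    by (auto simp: case_prod_unfold intro!: continuous_intros)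
  then show ?thesis
    unfolding eq by (rule integral_continuous_on_param)
qed

lemma
  assumes \<beta>: "norm \<beta> \<le> 1" and l: "norm l < 1" and z0: "z0 \<in> ball 0 1"
  shows continuous_on_prim_schur: "continuous_on (cball 0 1) (\<lambda>a. prim (schur \<beta> l a) z0)"
    and continuous_on_weight: "continuous_on (cball 0 1) (\<lambda>a. weight \<beta> l a z0)"
proof -
  have nz: "den \<beta> l (fst x) (snd x) \<noteq> 0" if "x \<in> cball 0 1 \<times> ball 0 1" for x
    using den_nonzero[OF \<beta> l, of "fst x" "snd x"] that by auto
  have den: "continuous_on A (\<lambda>x. den \<beta> l (fst x) (snd x))" for A
    unfolding den_def by (intro continuous_intros)
  have "continuous_on (cball 0 1 \<times> ball 0 1)
      (\<lambda>x. (fst x * snd x * (snd x + \<beta> * cnj l) + (l * snd x + \<beta>)) / den \<beta> l (fst x) (snd x))"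
    using nz by (intro continuous_intros den) auto
  then have "continuous_on (cball 0 1 \<times> ball 0 1) (\<lambda>(a, z). schur \<beta> l a z)"
    by (rule continuous_on_eq) (auto simp: schur_fraction[OF \<beta> l])
  then show "continuous_on (cball 0 1) (\<lambda>a. prim (schur \<beta> l a) z0)"
    by (rule continuous_on_prim_param[OF _ z0])
  have "continuous_on (cball 0 1 \<times> ball 0 1) (\<lambda>x. (snd x)\<^sup>2 * (1 / (den \<beta> l (fst x) (snd x))\<^sup>2))"
    using nz by (intro continuous_intros den) auto
  then have "continuous_on (cball 0 1 \<times> ball 0 1) (\<lambda>(a, z). z\<^sup>2 * (1 / (den \<beta> l a z)\<^sup>2))"
    by (simp add: case_prod_unfold)
  then show "continuous_on (cball 0 1) (\<lambda>a. weight \<beta> l a z0)"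
    unfolding weight_def
    by (rule continuous_on_prim_param[where h = "\<lambda>a z. z\<^sup>2 * (1 / (den \<beta> l a z)\<^sup>2)", OF _ z0])
qed

text \<open>Write \<open>weight \<beta> l a z0 = exp (L a)\<close> with \<open>L\<close> continuous on the closed disc. Then \<open>\<theta> + Im (L (cis \<theta>))\<close> is a
  continuous argument of the left-hand side which grows by exactly \<open>2 * pi\<close> over a full turn, so it takes every value
  modulo \<open>2 * pi\<close>.\<close>

lemma weight_attains_direction:
  assumes \<beta>: "norm \<beta> \<le> 1" and l: "norm l < 1" and z0: "z0 \<in> ball 0 1 - {0}" and u: "u \<noteq> 0"
  obtains \<theta> r where "\<theta> \<in> {-pi<..pi}" "r > 0" "cis \<theta> * weight \<beta> l (cis \<theta>) z0 = of_real r * u"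
proof -
  obtain L where L: "continuous_on (cball 0 1) L" "\<And>a. a \<in> cball 0 1 \<Longrightarrow> weight \<beta> l a z0 = exp (L a)"
    using continuous_logarithm_on_cball[OF continuous_on_weight[OF \<beta> l]] weight_nonzero[OF \<beta> l] z0
    by (metis DiffD1 mem_cball_0)
  define m where "m \<theta> = \<theta> + Im (L (cis \<theta>))" for \<theta> :: real
  have "continuous_on {-pi..pi} (\<lambda>\<theta>. L (cis \<theta>))"
    by (rule continuous_on_compose2[OF L(1)]) (auto intro!: continuous_intros)
  then have m: "continuous_on {-pi..pi} m"
    unfolding m_def by (intro continuous_intros)
  have mpi: "m pi = m (-pi) + 2 * pi"
    by (simp add: m_def cis_minus_pi)
  \<comment> \<open>The shift that puts \<open>Arg u + 2 * pi * k\<close> into the range of \<open>m\<close>, an interval of length \<open>2 * pi\<close>.\<close>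
  define k :: int where "k = \<lceil>(m (-pi) - Arg u) / (2 * pi)\<rceil>"
  define t where "t = Arg u + 2 * pi * of_int k"
  have "(m (-pi) - Arg u) / (2 * pi) \<le> of_int k" "of_int k < (m (-pi) - Arg u) / (2 * pi) + 1"
    unfolding k_def by linarith+
  then have "m (-pi) \<le> t" "t \<le> m pi"
    unfolding mpi t_def by (simp_all add: field_simps)
  then obtain \<theta>' where \<theta>': "-pi \<le> \<theta>'" "\<theta>' \<le> pi" "m \<theta>' = t"
    using IVT'[of m "-pi" t pi] m by auto
  have "cis \<theta>' * weight \<beta> l (cis \<theta>') z0 = of_real (exp (Re (L (cis \<theta>')))) * cis (m \<theta>')"
    unfolding m_def by (subst L(2)) (auto simp: exp_eq_polar[of "L (cis \<theta>')"] mult_ac simp flip: cis_mult)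
  also have "cis (m \<theta>') = cis (Arg u)"
    unfolding \<theta>' t_def by (simp flip: cis_mult)
  also have "\<dots> = of_real (inverse (norm u)) * u"
    using u by (simp add: cis_Arg sgn_div_norm scaleR_conv_of_real)
  finally have *: "cis \<theta>' * weight \<beta> l (cis \<theta>') z0 = of_real (exp (Re (L (cis \<theta>'))) * inverse (norm u)) * u"
    by simp
  \<comment> \<open>Both ends of the interval give the same point of the circle; only \<open>pi\<close> is admitted.\<close>
  define \<theta> where "\<theta> = (if \<theta>' = -pi then pi else \<theta>')"
  have "cis \<theta> = cis \<theta>'"
    by (simp add: \<theta>_def cis_minus_pi)
  show ?thesis
    by (rule that[of \<theta> "exp (Re (L (cis \<theta>'))) * inverse (norm u)"])
       (use * \<theta>' u in \<open>auto simp: \<open>cis \<theta> = cis \<theta>'\<close>\<close>, auto simp: \<theta>_def)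
qed

text \<open>A convex set with empty interior lies in a hyperplane, whose normal then supports it at every point.\<close>

lemma supporting_direction:
  fixes S :: "'a::euclidean_space set"
  assumes "convex S" "x \<in> S" "x \<notin> interior S"
  obtains u where "u \<noteq> 0" "\<And>y. y \<in> S \<Longrightarrow> u \<bullet> y \<le> u \<bullet> x"
proof (cases "interior S = {}")
  case True
  then obtain a b where "a \<noteq> 0" "S \<subseteq> {x. a \<bullet> x = b}"
    using empty_interior_subset_hyperplane[OF assms(1)] by blast
  then have "\<And>y. y \<in> S \<Longrightarrow> a \<bullet> y = a \<bullet> x"
    using assms(2) by blast
  then show ?thesis
    using that[OF \<open>a \<noteq> 0\<close>] by simp
next
  case False
  then have "x \<notin> rel_interior S"
    using assms(3) by (simp add: rel_interior_nonempty_interior)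
  moreover have "x \<in> closure S"
    using assms(2) closure_subset by blast
  ultimately obtain a where a: "a \<noteq> 0" "\<And>y. y \<in> closure S \<Longrightarrow> a \<bullet> x \<le> a \<bullet> y"
    using supporting_hyperplane_relative_frontier[OF assms(1)] by metis
  have "- a \<bullet> y \<le> - a \<bullet> x" if "y \<in> S" for y
    using a(2)[of y] closure_subset[of S] that by auto
  then show ?thesis
    using that[of "- a"] a(1) by simp
qed

section \<open>The boundary curve\<close>

lemma
  assumes \<beta>: "norm \<beta> \<le> 1" and l: "norm l < 1" and a: "norm a \<le> 1"
  shows holomorphic_F: "F \<alpha> \<beta> M a l holomorphic_on ball 0 1"
    and deriv_F: "\<And>z. z \<in> ball 0 1 \<Longrightarrow> deriv (F \<alpha> \<beta> M a l) z = \<alpha> + of_real M * prim (schur \<beta> l a) z"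
    and F_0: "F \<alpha> \<beta> M a l 0 = 0"
proof -
  have hols: "schur \<beta> l a holomorphic_on ball 0 1"
    using holomorphic_schur[OF \<beta> l, of "\<lambda>_. a"] a by simp
  have int: "integrand \<beta> M a l = (\<lambda>z. of_real M * schur \<beta> l a z)"
    by (simp add: integrand_eq_schur fun_eq_iff)
  have holi: "integrand \<beta> M a l holomorphic_on ball 0 1"
    unfolding int using hols by (intro holomorphic_intros)
  have holp: "prim (integrand \<beta> M a l) holomorphic_on ball 0 1"
    by (rule holomorphic_prim[OF holi])
  have Feq: "F \<alpha> \<beta> M a l = (\<lambda>z. prim (prim (integrand \<beta> M a l)) z + \<alpha> * z)"
    by (simp add: F_def prim_def[abs_def] fun_eq_iff)
  have dF: "(F \<alpha> \<beta> M a l has_field_derivative prim (integrand \<beta> M a l) z + \<alpha>) (at z)" if "z \<in> ball 0 1" for z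
    unfolding Feq using has_field_derivative_prim[OF holp that] by (auto intro!: derivative_eq_intros)
  have pi: "prim (integrand \<beta> M a l) z = of_real M * prim (schur \<beta> l a) z" if "z \<in> ball 0 1" for z
    unfolding int by (rule prim_cmult[OF hols that])
  show "F \<alpha> \<beta> M a l holomorphic_on ball 0 1"
    using dF by (meson holomorphic_on_open open_ball)
  show "deriv (F \<alpha> \<beta> M a l) z = \<alpha> + of_real M * prim (schur \<beta> l a) z" if "z \<in> ball 0 1" for z
    using DERIV_imp_deriv[OF dF[OF that]] pi[OF that] by simp
  show "F \<alpha> \<beta> M a l 0 = 0"
    by (simp add: Feq)
qed

theorem theorem2p11:
  fixes \<alpha> \<beta> l z0 :: complex and M :: real
  assumes "0 < M" and "M \<le> norm \<alpha>" and "norm \<beta> \<le> 1"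
    and "l \<in> ball 0 1" and "z0 \<in> ball 0 1 - {0}"
  shows "(\<forall>\<theta>\<in>{-pi<..pi}. F'_curve \<alpha> \<beta> M l z0 \<theta> =
            contour_integral (linepath 0 z0) (\<lambda>\<zeta>. integrand \<beta> M (cis \<theta>) l \<zeta>) + \<alpha>) \<and>
         frontier (V1 \<alpha> \<beta> M z0 l) = F'_curve \<alpha> \<beta> M l z0 ` {-pi<..pi} \<and>
         path (F'_curve \<alpha> \<beta> M l z0 \<circ> linepath (-pi) pi) \<and>
         F'_curve \<alpha> \<beta> M l z0 (-pi) = F'_curve \<alpha> \<beta> M l z0 pi \<and>
         (norm \<beta> < 1 \<longrightarrow> simple_path (F'_curve \<alpha> \<beta> M l z0 \<circ> linepath (-pi) pi)) \<and>
         (\<forall>f\<in>class_S1 \<alpha> \<beta> M l. \<forall>\<theta>\<in>{-pi<..pi}.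
            deriv f z0 = F'_curve \<alpha> \<beta> M l z0 \<theta> \<longrightarrow>
            (\<forall>z\<in>ball 0 1. f z = F \<alpha> \<beta> M (cis \<theta>) l z))"
proof -
  note M = assms(1,2) and \<beta> = assms(3) and z0 = assms(5)
  have l: "norm l < 1" and z0': "z0 \<in> ball 0 1"
    using assms(4,5) by auto
  define s where "s \<theta> = schur \<beta> l (cis \<theta>)" for \<theta>
  have s: "s \<theta> \<in> schur_class \<beta> l" for \<theta>
    unfolding s_def by (rule schur_mem_class[OF \<beta> l]) simp
  have curve: "F'_curve \<alpha> \<beta> M l z0 \<theta> = \<alpha> + of_real M * prim (s \<theta>) z0" for \<theta>
    unfolding F'_curve_def s_def by (rule deriv_F[OF \<beta> l _ z0']) simp
  have curve_in: "F'_curve \<alpha> \<beta> M l z0 \<theta> \<in> V1 \<alpha> \<beta> M z0 l" for \<theta>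
    unfolding V1_eq_schur_values[OF M z0'] curve using s by blast
  \<comment> \<open>A curve point determines its function: the extremal inequality is strict, and for \<open>|\<beta>| = 1\<close> there is
    only one function.\<close>
  have rigid: "\<forall>z\<in>ball 0 1. g z = s \<theta> z"
    if g: "g \<in> schur_class \<beta> l" "prim g z0 = prim (s \<theta>) z0" for g \<theta>
  proof (cases "norm \<beta> < 1")
    case True
    then show ?thesis
      using schur_class_extremal[OF True l _ z0 g(1), of "cis \<theta>"] g(2) by (simp add: s_def)
  next
    case False
    then show ?thesis
      using schur_class_unimodular[of \<beta>] g(1) s \<beta> by (metis order_antisym_conv linorder_not_less)
  qed

  have "F'_curve \<alpha> \<beta> M l z0 \<theta> = contour_integral (linepath 0 z0) (integrand \<beta> M (cis \<theta>) l) + \<alpha>" for \<theta>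
  proof -
    have hol: "s \<theta> holomorphic_on ball 0 1"
      using s by (simp add: schur_class_def)
    have "contour_integral (linepath 0 z0) (integrand \<beta> M (cis \<theta>) l) = prim (\<lambda>z. of_real M * s \<theta> z) z0"
      by (simp add: prim_def s_def integrand_eq_schur[abs_def])
    also have "\<dots> = of_real M * prim (s \<theta>) z0"
      by (rule prim_cmult[OF hol z0'])
    finally show ?thesis
      by (simp add: curve)
  qed
  moreover have "frontier (V1 \<alpha> \<beta> M z0 l) = F'_curve \<alpha> \<beta> M l z0 ` {-pi<..pi}"
  proof (cases "norm \<beta> < 1")
    case True
    show ?thesis
    proof (intro equalityI subsetI)
      fix v assume "v \<in> frontier (V1 \<alpha> \<beta> M z0 l)"
      then have v: "v \<in> V1 \<alpha> \<beta> M z0 l" "v \<notin> interior (V1 \<alpha> \<beta> M z0 l)"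
        using closed_V1[OF M z0'] by (auto simp: frontier_def)
      obtain u where u: "u \<noteq> 0" "\<And>w. w \<in> V1 \<alpha> \<beta> M z0 l \<Longrightarrow> u \<bullet> w \<le> u \<bullet> v"
        by (rule supporting_direction[OF convex_V1[OF M z0'] v], rule that)
      obtain \<theta> r where \<theta>: "\<theta> \<in> {-pi<..pi}" "r > 0" "cis \<theta> * weight \<beta> l (cis \<theta>) z0 = of_real r * u"
        by (rule weight_attains_direction[OF \<beta> l z0 u(1)], rule that)
      obtain g where g: "g \<in> schur_class \<beta> l" "v = \<alpha> + of_real M * prim g z0"
        using v(1) unfolding V1_eq_schur_values[OF M z0'] by blast
      \<comment> \<open>The supporting line at \<open>v\<close> has the normal of the curve point \<open>\<theta>\<close>, so it yields the inequality
        opposite to the extremal one.\<close>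
      define d where "d = prim g z0 - prim (s \<theta>) z0"
      have "of_real M * d = M *\<^sub>R d"
        by (simp add: scaleR_conv_of_real)
      moreover have "u \<bullet> (of_real M * d) \<ge> 0"
        using u(2)[OF curve_in[of \<theta>]] by (simp add: curve g(2) d_def inner_simps right_diff_distrib)
      ultimately have "u \<bullet> d \<ge> 0"
        using M by (simp add: zero_le_mult_iff)
      then have "(r *\<^sub>R u) \<bullet> d \<ge> 0"
        using \<theta>(2) by simp
      moreover have "Re (d / w) = (w \<bullet> d) / (norm w)\<^sup>2" for w
        by (simp add: Re_divide inner_complex_def cmod_power2 mult_ac)
      ultimately have "Re (d / (cis \<theta> * weight \<beta> l (cis \<theta>) z0)) \<ge> 0"
        unfolding \<theta>(3) scaleR_conv_of_real by simp
      then have "\<forall>z\<in>ball 0 1. g z = s \<theta> z"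
        using schur_class_extremal[OF True l _ z0 g(1), of "cis \<theta>"] by (auto simp: s_def d_def)
      then have "prim g z0 = prim (s \<theta>) z0"
        using z0' by (intro prim_cong) auto
      then show "v \<in> F'_curve \<alpha> \<beta> M l z0 ` {-pi<..pi}"
        using \<theta>(1) g(2) curve by auto
    next
      fix v assume "v \<in> F'_curve \<alpha> \<beta> M l z0 ` {-pi<..pi}"
      then obtain \<theta> where v: "v = F'_curve \<alpha> \<beta> M l z0 \<theta>"
        by blast
      define W where "W = cis \<theta> * weight \<beta> l (cis \<theta>) z0"
      have W: "W \<noteq> 0"
        using weight_nonzero[OF \<beta> l _ z0, of "cis \<theta>"] by (simp add: W_def)
      have "v \<notin> interior (V1 \<alpha> \<beta> M z0 l)"
      proof
        assume "v \<in> interior (V1 \<alpha> \<beta> M z0 l)"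
        then obtain e where e: "e > 0" "ball v e \<subseteq> V1 \<alpha> \<beta> M z0 l"
          by (auto simp: mem_interior)
        \<comment> \<open>A step in the outer normal direction, half as long as the radius \<open>e\<close>.\<close>
        define k where "k = e / (2 * norm W)"
        have k: "k > 0"
          using e W by (simp add: k_def)
        have "v + of_real k * W \<in> ball v e"
          using e(1) W k by (simp add: dist_norm norm_mult) (simp add: k_def)
        then obtain g where g: "g \<in> schur_class \<beta> l" "v + of_real k * W = \<alpha> + of_real M * prim g z0"
          using e(2) unfolding V1_eq_schur_values[OF M z0'] by blast
        have "(prim g z0 - prim (s \<theta>) z0) / W = of_real (k / M)"
          using g(2) W M unfolding v curve by (simp add: field_simps)
        then have "Re ((prim g z0 - prim (s \<theta>) z0) / W) > 0"
          using k M by simp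
        moreover have "prim g z0 = prim (s \<theta>) z0" if "\<forall>z\<in>ball 0 1. g z = s \<theta> z"
          using that z0' by (intro prim_cong) auto
        ultimately show False
          using schur_class_extremal[OF True l _ z0 g(1), of "cis \<theta>"] by (auto simp: s_def W_def)
      qed
      then show "v \<in> frontier (V1 \<alpha> \<beta> M z0 l)"
        using curve_in[of \<theta>] v closure_subset by (auto simp: frontier_def)
    qed
  next
    case False
    then have \<beta>1: "norm \<beta> = 1"
      using \<beta> by simp
    define w where "w = \<alpha> + of_real M * prim (\<lambda>_. \<beta>) z0"
    have val: "\<alpha> + of_real M * prim g z0 = w" if "g \<in> schur_class \<beta> l" for g
      unfolding w_def using schur_class_unimodular[OF \<beta>1 that] prim_cong[of g "\<lambda>_. \<beta>"] z0' by simp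
    have "V1 \<alpha> \<beta> M z0 l = {w}"
      unfolding V1_eq_schur_values[OF M z0'] using val s by auto
    moreover have "F'_curve \<alpha> \<beta> M l z0 ` {-pi<..pi} = {w}"
      using val[OF s] by (auto simp: curve intro!: image_eqI[of _ _ pi])
    ultimately show ?thesis
      by (simp add: frontier_def)
  qed
  moreover have path: "path (F'_curve \<alpha> \<beta> M l z0 \<circ> linepath (-pi) pi)"
  proof -
    have "continuous_on {0..1} (\<lambda>t. prim (schur \<beta> l (cis (linepath (-pi) pi t))) z0)"
      by (rule continuous_on_compose2[OF continuous_on_prim_schur[OF \<beta> l z0']]) (auto intro!: continuous_intros)
    then show ?thesis
      unfolding path_def o_def curve s_def by (intro continuous_intros)
  qed
  moreover have "F'_curve \<alpha> \<beta> M l z0 (-pi) = F'_curve \<alpha> \<beta> M l z0 pi"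
    by (simp add: F'_curve_def cis_minus_pi)
  moreover have "simple_path (F'_curve \<alpha> \<beta> M l z0 \<circ> linepath (-pi) pi)" if \<beta>1: "norm \<beta> < 1"
  proof -
    have inj: "cis \<theta> = cis \<eta>" if "F'_curve \<alpha> \<beta> M l z0 \<theta> = F'_curve \<alpha> \<beta> M l z0 \<eta>" for \<theta> \<eta>
    proof -
      have "prim (s \<theta>) z0 = prim (s \<eta>) z0"
        using that M by (simp add: curve)
      \<comment> \<open>The two functions are equal on the whole disc; any point other than 0 separates the parameters.\<close>
      then have "s \<theta> (1/2) - s \<eta> (1/2) = 0"
        using rigid[OF s[of \<theta>], of \<eta>] by (simp add: norm_divide)
      moreover have "(norm \<beta>)\<^sup>2 < 1" "(norm l)\<^sup>2 < 1"
        using \<beta>1 l by (simp_all add: abs_square_less_1)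
      then have "(1 - (norm \<beta>)\<^sup>2) * (1 - (norm l)\<^sup>2) \<noteq> 0"
        by simp
      moreover have "den \<beta> l (cis \<theta>) (1/2) \<noteq> 0" "den \<beta> l (cis \<eta>) (1/2) \<noteq> 0"
        by (rule den_nonzero[OF \<beta> l]; simp add: norm_divide)+
      ultimately show ?thesis
        using schur_diff[OF \<beta> l, of "cis \<theta>" "cis \<eta>" "1/2"]
        by (simp add: s_def norm_divide del: of_real_mult of_real_diff)
    qed
    have "loop_free (F'_curve \<alpha> \<beta> M l z0 \<circ> linepath (-pi) pi)"
      unfolding loop_free_def
    proof (intro ballI impI)
      fix x y :: real
      assume xy: "x \<in> {0..1}" "y \<in> {0..1}"
        and eq: "(F'_curve \<alpha> \<beta> M l z0 \<circ> linepath (-pi) pi) x = (F'_curve \<alpha> \<beta> M l z0 \<circ> linepath (-pi) pi) y"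
      have lp: "linepath (-pi) pi t = (2 * t - 1) * pi" for t
        by (simp add: linepath_def algebra_simps)
      have range: "-pi \<le> (2 * t - 1) * pi" "(2 * t - 1) * pi \<le> pi" if "t \<in> {0..1}" for t
        using mult_right_mono[of "-1" "2 * t - 1" pi] mult_right_mono[of "2 * t - 1" 1 pi] that by auto
      have "cis ((2 * x - 1) * pi) = cis ((2 * y - 1) * pi)"
        by (rule inj) (use eq in \<open>simp add: lp\<close>)
      from cis_eq_cisD[OF range[OF xy(1)] range[OF xy(2)] this]
      consider "(2 * x - 1) * pi = (2 * y - 1) * pi" | "(2 * x - 1) * pi = (-1) * pi" "(2 * y - 1) * pi = 1 * pi"
        | "(2 * x - 1) * pi = 1 * pi" "(2 * y - 1) * pi = (-1) * pi"
        by auto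
      then show "x = y \<or> x = 0 \<and> y = 1 \<or> x = 1 \<and> y = 0"
        unfolding mult_cancel_right by cases auto
    qed
    then show ?thesis
      using path by (simp add: simple_path_def)
  qed
  moreover have "f z = F \<alpha> \<beta> M (cis \<theta>) l z"
    if f: "f \<in> class_S1 \<alpha> \<beta> M l" and eq: "deriv f z0 = F'_curve \<alpha> \<beta> M l z0 \<theta>" and z: "z \<in> ball 0 1" for f \<theta> z
  proof -
    obtain g where g: "g \<in> schur_class \<beta> l" "f holomorphic_on ball 0 1" "f 0 = 0"
      "\<And>z. z \<in> ball 0 1 \<Longrightarrow> deriv f z = \<alpha> + of_real M * prim g z"
      by (rule class_S1D[OF M(1) f], rule that)
    have "prim g z0 = prim (s \<theta>) z0"
      using eq g(4)[OF z0'] M by (simp add: curve)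
    then have gs: "\<forall>z\<in>ball 0 1. g z = s \<theta> z"
      by (rule rigid[OF g(1)])
    have holF: "F \<alpha> \<beta> M (cis \<theta>) l holomorphic_on ball 0 1" and F0: "F \<alpha> \<beta> M (cis \<theta>) l 0 = 0"
      by (simp_all add: holomorphic_F[OF \<beta> l] F_0[OF \<beta> l])
    have "f z = prim (deriv f) z"
      using prim_eq[of f "deriv f", OF _ z] g(2,3) by (simp add: holomorphic_derivI)
    also have "\<dots> = prim (deriv (F \<alpha> \<beta> M (cis \<theta>) l)) z"
    proof (rule prim_cong[OF _ z])
      fix w :: complex assume w: "w \<in> ball 0 1"
      have "prim g w = prim (s \<theta>) w"
        using gs w by (intro prim_cong) auto
      then show "deriv f w = deriv (F \<alpha> \<beta> M (cis \<theta>) l) w"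
        using g(4)[OF w] deriv_F[OF \<beta> l _ w, of "cis \<theta>"] by (simp add: s_def)
    qed
    also have "\<dots> = F \<alpha> \<beta> M (cis \<theta>) l z"
      using prim_eq[of "F \<alpha> \<beta> M (cis \<theta>) l" "deriv (F \<alpha> \<beta> M (cis \<theta>) l)", OF _ z] holF F0
      by (simp add: holomorphic_derivI)
    finally show ?thesis .
  qed
  ultimately show ?thesis
    by blast
qed

end
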